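(* Let $q$ be a prime power, let $1\le k\le n\le m$ be integers, let $w$ be an integer with $w>\frac{n-k}{2}$, put $\xi:=w-\frac{n-k}{2}$, and let $Gab_k(\boldsymbol g)\subseteq\mathbb{F}_{q^m}^n$ be a Gabidulin code of length $n$ and dimension $k$. Let $\boldsymbol r$ be a uniformly distributed random element of $\mathbb{F}_{q^m}^n$. Then the column-erasure-aided randomized decoder (described in the context) requires on average at least $$\mathcal{W}_{RD}=\min_{\delta\in[2\xi,n-k]}\left\{\frac{n^2}{\sum_{j=0}^{w}\bar A_j\,P_{n,k,\delta,j}}\right\}$$ $$=\min_{\delta\in[2\xi,n-k]}\left\{\frac{n^2\begin{bmatrix} n\\ \delta\end{bmatrix}_q}{\begin{bmatrix} n\\ \delta\end{bmatrix}_q\displaystyle\sum_{j=0}^{\lfloor\frac{n-k-\delta}{2}\rfloor}\bar A_j+\sum_{j=\lfloor\frac{n-k-\delta}{2}\rfloor+1}^{w}\bar A_j\left(\sum_{i=\lceil j-\frac{n-k}{2}+\frac{\delta}{2}\rceil}^{\min\{\delta,j\}}\begin{bmatrix} n-j\\ \delta-i\end{bmatrix}_q\begin{bmatrix} j\\ i\end{bmatrix}_q q^{(j-i)(\delta-i)}\right)}\right\}$$ operations over $\mathbb{F}_{q^m}$ to output a codeword $\boldsymbol c\in Gab_k(\boldsymbol g)$ such that $\mathrm{rk}(\boldsymbol r-\boldsymbol c)\le w$, where $$\bar A_j=q^{m(k-n)}\prod_{\ell=0}^{j-1}\frac{(q^m-q^{\ell})(q^n-q^{\ell})}{q^j-q^{\ell}},$$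 and $P_{n,k,\delta,j}:=\begin{bmatrix} n\\ \delta\end{bmatrix}_q^{-1}\sum_{i=\lceil j-\frac{n-k}{2}+\frac{\delta}{2}\rceil}^{\min\{\delta,j\}}\begin{bmatrix} n-j\\ \delta-i\end{bmatrix}_q\begin{bmatrix} j\\ i\end{bmatrix}_q q^{(j-i)(\delta-i)}$ if $2j+\delta>n-k$, and $P_{n,k,\delta,j}:=1$ otherwise.
   Context: Notation. $\mathbb{F}_{q^m}$ is the degree-$m$ extension of $\mathbb{F}_q$. For $\boldsymbol a\in\mathbb{F}_{q^m}^n$, $\mathrm{rk}(\boldsymbol a)$ is the dimension of the $\mathbb{F}_q$-span of its entries. $\begin{bmatrix} a\\ b\end{bmatrix}_q$ is the Gaussian binomial coefficient (the number of $b$-dimensional subspaces of $\mathbb{F}_q^a$; zero if $b<0$ or $b>a$). Intervals $[2\xi,n-k]$ for $\delta$ consist of integers (note that $2\xi$ is an integer). Gabidulin code. For $\boldsymbol g=(g_1,\dots,g_n)\in\mathbb{F}_{q^m}^n$ with entries linearly independent over $\mathbb{F}_q$, $Gab_k(\boldsymbol g)$ is the $\mathbb{F}_{q^m}$-linear code generated by the $k\times n$ matrix with $(i,j)$ entry $g_j^{q^{i-1}}$. Error-erasure decoder. Given $\boldsymbol r\in\mathbb{F}_{q^m}^n$ and a full-rank matrix $\boldsymbol B_C\in\mathbb{F}_q^{\delta\times n}$ (with row space $\mathcal U$), the decoder returns the codeword $\boldsymbol c\in Gab_k(\boldsymbol g)$ for which there is $\boldsymbol a_C\in\mathbb{F}_{q^m}^{\delta}$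 with $t:=\mathrm{rk}(\boldsymbol r-\boldsymbol c-\boldsymbol a_C\boldsymbol B_C)$ satisfying $2t+\delta\le n-k$, if such a codeword exists, and otherwise declares failure. Equivalently, it returns $\boldsymbol c$ exactly when $2(\mathrm{rk}(\boldsymbol r-\boldsymbol c)-\epsilon)+\delta\le n-k$, where $\epsilon$ is the dimension of the intersection of $\mathcal U$ with the row space of $\boldsymbol r-\boldsymbol c$ (the $\mathbb{F}_q$-row space in $\mathbb{F}_q^n$ of the $m\times n$ matrix over $\mathbb{F}_q$ obtained by expanding entries in an $\mathbb{F}_q$-basis of $\mathbb{F}_{q^m}$). Column-erasure-aided randomized decoder. Inputs: $\boldsymbol r$, an integer $\delta\in[2\xi,n-k]$, and $w$. In each iteration, choose a $\delta$-dimensional subspace $\mathcal U$ of $\mathbb{F}_q^n$ uniformly at random (independently over iterations), let $\boldsymbol B_C$ be a full-rank matrix with row space $\mathcal U$, and run the error-erasure decoder on $(\boldsymbol r,\boldsymbol B_C)$. If it returns a codeword $\hat{\boldsymbol c}$ with $\mathrm{rk}(\boldsymbol r-\hat{\boldsymbol c})\le w$, output $\hat{\boldsymbol c}$ and stop; otherwise go to the next iteration. Cost convention: each iteration (one call to the error-erasure decoder) is counted as $n^2$ operations over $\mathbb{F}_{q^m}$, and no cap on the number of iterations is imposed, so the average number of operations is $n^2$ times the expected number of iterations (over the random $\boldsymbol r$ and the random guesses). *)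

theory Defs
  imports
    "HOL-Analysis.Analysis"
    "HOL-Probability.Probability"
    "HOL-Library.Function_Algebras"
begin

section \<open>The extension of finite fields\<close>

text \<open>
  The field with \<open>q\<close> elements is a type \<open>'k\<close> of class \<open>field\<close> and \<open>finite\<close>; it sits inside its
  extension \<open>'a\<close> via a ring homomorphism \<open>emb\<close> (which is automatically injective).
\<close>

definition field_embedding :: "('k::field \<Rightarrow> 'a::field) \<Rightarrow> bool" where
  "field_embedding emb \<longleftrightarrow>
     emb 1 = 1 \<and> (\<forall>x y. emb (x + y) = emb x + emb y) \<and> (\<forall>x y. emb (x * y) = emb x * emb y)"

definition ext_scale :: "('k::field \<Rightarrow> 'a::field) \<Rightarrow> 'k \<Rightarrow> 'a \<Rightarrow> 'a" where
  "ext_scale emb c x = emb c * x"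

lemma vector_space_ext_scale:
  assumes "field_embedding emb"
  shows "vector_space (ext_scale emb)"
  using assms by unfold_locales (auto simp: field_embedding_def ext_scale_def algebra_simps)

definition ext_degree :: "('k::field \<Rightarrow> 'a::field) \<Rightarrow> nat" where
  "ext_degree emb = vector_space.dim (ext_scale emb) (UNIV :: 'a set)"

definition lin_indep_entries :: "('k::field \<Rightarrow> 'a::field) \<Rightarrow> 'a ^ 'n \<Rightarrow> bool" where
  "lin_indep_entries emb g \<longleftrightarrow>
     inj (\<lambda>j. g $ j) \<and> \<not> module.dependent (ext_scale emb) (range (\<lambda>j. g $ j))"

definition rk :: "('k::field \<Rightarrow> 'a::field) \<Rightarrow> 'a ^ 'n \<Rightarrow> nat" where
  "rk emb x = vector_space.dim (ext_scale emb)
                (module.span (ext_scale emb) (range (\<lambda>j. x $ j)))"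

section \<open>Gaussian binomial coefficients\<close>

text \<open>
  The coordinate space of dimension \<open>a\<close> over \<open>'k\<close> consists of the functions on the natural
  numbers that vanish outside \<open>{..<a}\<close>, since \<open>a\<close> varies inside the formulas below.
\<close>

definition fun_scale :: "'k::field \<Rightarrow> (nat \<Rightarrow> 'k) \<Rightarrow> nat \<Rightarrow> 'k" where
  "fun_scale c f = (\<lambda>i. c * f i)"

lemma vector_space_fun_scale: "vector_space fun_scale"
  by unfold_locales (auto simp: fun_scale_def fun_eq_iff algebra_simps)

definition coord_space :: "nat \<Rightarrow> (nat \<Rightarrow> 'k::field) set" where
  "coord_space a = {f. \<forall>i\<ge>a. f i = 0}"

definition gauss_binomial :: "'k::{field,finite} itself \<Rightarrow> nat \<Rightarrow> nat \<Rightarrow> nat" where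
  "gauss_binomial _ a b =
     card {S :: (nat \<Rightarrow> 'k) set. module.subspace fun_scale S \<and> S \<subseteq> coord_space a \<and>
             vector_space.dim fun_scale S = b}"

section \<open>Gabidulin codes and the error-erasure decoder\<close>

definition Gab :: "nat \<Rightarrow> 'a::field ^ 'n \<Rightarrow> 'k::{field,finite} itself \<Rightarrow> ('a ^ 'n) set" where
  "Gab k g _ = vec.span ((\<lambda>i. \<chi> j. (g $ j) ^ (CARD('k) ^ i)) ` {..<k})"

text \<open>
  A matrix with \<open>\<delta>\<close> rows over \<open>'k\<close> is the family of its rows \<open>B 0, \<dots>, B (\<delta> - 1)\<close>; the number
  of rows is not a type because \<open>\<delta>\<close> is an input of the decoder.
\<close>

definition row_space :: "nat \<Rightarrow> (nat \<Rightarrow> 'k::field ^ 'n) \<Rightarrow> ('k ^ 'n) set" where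
  "row_space \<delta> B = vec.span (B ` {..<\<delta>})"

definition full_rank :: "nat \<Rightarrow> (nat \<Rightarrow> 'k::field ^ 'n) \<Rightarrow> bool" where
  "full_rank \<delta> B \<longleftrightarrow> vec.dim (row_space \<delta> B) = \<delta>"

definition vec_mat_mult ::
  "('k::field \<Rightarrow> 'a::field) \<Rightarrow> nat \<Rightarrow> (nat \<Rightarrow> 'a) \<Rightarrow> (nat \<Rightarrow> 'k ^ 'n) \<Rightarrow> 'a ^ 'n" where
  "vec_mat_mult emb \<delta> a B = (\<chi> j. \<Sum>i<\<delta>. a i * emb (B i $ j))"

definition decodable ::
  "('k::{field,finite} \<Rightarrow> 'a::field) \<Rightarrow> nat \<Rightarrow> 'a ^ 'n \<Rightarrow> nat \<Rightarrow> (nat \<Rightarrow> 'k ^ 'n)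
     \<Rightarrow> 'a ^ 'n \<Rightarrow> 'a ^ 'n \<Rightarrow> bool" where
  "decodable emb k g \<delta> B r c \<longleftrightarrow>
     c \<in> Gab k g TYPE('k) \<and>
     (\<exists>a. 2 * rk emb (r - c - vec_mat_mult emb \<delta> a B) + \<delta> \<le> CARD('n) - k)"

text \<open>
  If the entries of \<open>g\<close> are linearly independent and \<open>k \<le> n\<close>, at most one codeword is
  decodable, because the minimum rank distance of the code is \<open>n - k + 1\<close>, so the choice below
  is not a real one; \<open>None\<close> is the decoding failure.
\<close>

definition error_erasure_decoder ::
  "('k::{field,finite} \<Rightarrow> 'a::field) \<Rightarrow> nat \<Rightarrow> 'a ^ 'n \<Rightarrow> nat \<Rightarrow> (nat \<Rightarrow> 'k ^ 'n)
     \<Rightarrow> 'a ^ 'n \<Rightarrow> ('a ^ 'n) option" where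
  "error_erasure_decoder emb k g \<delta> B r =
     (if \<exists>c. decodable emb k g \<delta> B r c
      then Some (SOME c. decodable emb k g \<delta> B r c) else None)"

section \<open>The column-erasure-aided randomized decoder\<close>

definition basis_matrix :: "nat \<Rightarrow> ('k::field ^ 'n) set \<Rightarrow> nat \<Rightarrow> 'k ^ 'n" where
  "basis_matrix \<delta> U = (SOME B. full_rank \<delta> B \<and> row_space \<delta> B = U)"

definition rd_iteration ::
  "('k::{field,finite} \<Rightarrow> 'a::field) \<Rightarrow> nat \<Rightarrow> 'a ^ 'n \<Rightarrow> nat \<Rightarrow> nat
     \<Rightarrow> 'a ^ 'n \<Rightarrow> ('k ^ 'n) set \<Rightarrow> ('a ^ 'n) option" where
  "rd_iteration emb k g w \<delta> r U =
     (case error_erasure_decoder emb k g \<delta> (basis_matrix \<delta> U) r of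
        None \<Rightarrow> None
      | Some c \<Rightarrow> if rk emb (r - c) \<le> w then Some c else None)"

definition rd_num_iterations ::
  "('k::{field,finite} \<Rightarrow> 'a::field) \<Rightarrow> nat \<Rightarrow> 'a ^ 'n \<Rightarrow> nat \<Rightarrow> nat
     \<Rightarrow> 'a ^ 'n \<Rightarrow> (nat \<Rightarrow> ('k ^ 'n) set) \<Rightarrow> ennreal" where
  "rd_num_iterations emb k g w \<delta> r \<omega> =
     (if \<exists>i. rd_iteration emb k g w \<delta> r (\<omega> i) \<noteq> None
      then of_nat (Suc (LEAST i. rd_iteration emb k g w \<delta> r (\<omega> i) \<noteq> None))
      else \<infinity>)"

definition guess_pmf :: "nat \<Rightarrow> ('k::{field,finite} ^ 'n) set pmf" where
  "guess_pmf \<delta> = pmf_of_set {U. vec.subspace U \<and> vec.dim U = \<delta>}"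

text \<open>
  The received word is uniform and independent of the sequence of guesses, which are independent
  and identically distributed. The expectation is \<open>\<infinity>\<close> as soon as, with positive probability,
  no iteration ever succeeds.
\<close>

definition rd_space ::
  "nat \<Rightarrow> (('a::{field,finite} ^ 'n) \<times> (nat \<Rightarrow> ('k::{field,finite} ^ 'n) set)) measure" where
  "rd_space \<delta> =
     measure_pmf (pmf_of_set UNIV) \<Otimes>\<^sub>M (\<Pi>\<^sub>M i\<in>(UNIV :: nat set). measure_pmf (guess_pmf \<delta>))"

definition rd_average_cost ::
  "('k::{field,finite} \<Rightarrow> 'a::{field,finite}) \<Rightarrow> nat \<Rightarrow> 'a ^ 'n \<Rightarrow> nat \<Rightarrow> nat \<Rightarrow> ennreal" where
  "rd_average_cost emb k g w \<delta> =
     of_nat (CARD('n) ^ 2) *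
       (\<integral>\<^sup>+ (r, \<omega>). rd_num_iterations emb k g w \<delta> r \<omega> \<partial>rd_space \<delta>)"

section \<open>The bound\<close>

text \<open>
  The integers \<open>\<delta>\<close> of the interval \<open>[2 * \<xi>, n - k]\<close>; it is empty if \<open>w > n - k\<close>.
\<close>

definition erasure_range :: "nat \<Rightarrow> nat \<Rightarrow> real \<Rightarrow> nat set" where
  "erasure_range n k \<xi> = {\<delta>. 2 * \<xi> \<le> real \<delta> \<and> real \<delta> \<le> real n - real k}"

definition A_bar :: "nat \<Rightarrow> nat \<Rightarrow> nat \<Rightarrow> nat \<Rightarrow> nat \<Rightarrow> real" where
  "A_bar q m n k j =
     real q powi (int m * (int k - int n)) *
       (\<Prod>l<j. (real q ^ m - real q ^ l) * (real q ^ n - real q ^ l) / (real q ^ j - real q ^ l))"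

text \<open>
  The conversions to \<open>nat\<close> and the subtractions below do not truncate for \<open>\<delta>\<close> in the interval
  above and \<open>j \<le> w\<close>: the lower summation limit is only used if \<open>2 * j + \<delta> > n - k\<close>, hence it is
  positive, and \<open>j \<le> w \<le> n - k\<close> as the interval is nonempty.
\<close>

definition P_succ :: "'k::{field,finite} itself \<Rightarrow> nat \<Rightarrow> nat \<Rightarrow> nat \<Rightarrow> nat \<Rightarrow> real" where
  "P_succ T n k \<delta> j =
     (if 2 * j + \<delta> > n - k
      then inverse (real (gauss_binomial T n \<delta>)) *
             (\<Sum>i = nat \<lceil>real j - (real n - real k) / 2 + real \<delta> / 2\<rceil>..min \<delta> j.
                real (gauss_binomial T (n - j) (\<delta> - i)) * real (gauss_binomial T j i) *
                  real CARD('k) ^ ((j - i) * (\<delta> - i)))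
      else 1)"

definition W_RD :: "'k::{field,finite} itself \<Rightarrow> nat \<Rightarrow> nat \<Rightarrow> nat \<Rightarrow> nat \<Rightarrow> real \<Rightarrow> real" where
  "W_RD T m n k w \<xi> =
     Min ((\<lambda>\<delta>. real n ^ 2 / (\<Sum>j = 0..w. A_bar CARD('k) m n k j * P_succ T n k \<delta> j))
            ` erasure_range n k \<xi>)"

end

theory Submission
  imports Defs
begin

text \<open>
  Given \<open>r\<close>, the number of iterations is geometric with the success probability \<open>p r\<close> of a single
  guess, so its mean is \<open>1 / p r\<close>, and by Jensen's inequality its average over \<open>r\<close> is at least
  \<open>1 / s\<close> for every upper bound \<open>s\<close> of the average of \<open>p r\<close>.  A union bound over the codewords and
  the substitution \<open>e = r - c\<close> bound the average of \<open>p r\<close>: a guess \<open>U\<close> can only succeed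
  through \<open>c\<close> if \<open>2 (rk e - \<epsilon>) + \<delta> \<le> n - k\<close>, where \<open>\<epsilon>\<close> is the dimension of the intersection of
  \<open>U\<close> with the row space of \<open>e\<close>.  It remains to count the vectors \<open>e\<close> of a given rank and the
  subspaces \<open>U\<close> with a given \<open>\<epsilon>\<close>, for which upper bounds suffice; this is done by counting lists
  of vectors that are linearly independent modulo a subspace.
\<close>

section \<open>Counting subspaces over finite fields\<close>

locale finite_field_space = vector_space scale
  for scale :: "'k::{field,finite} \<Rightarrow> 'b::ab_group_add \<Rightarrow> 'b"
begin

section \<open>Sizes of spans and of lists independent modulo a subspace\<close>

lemma card_scalars_gt_1: "1 < CARD('k)"
proof -
  have "card {0, 1 :: 'k} \<le> CARD('k)"
    by (intro card_mono) auto
  then show ?thesis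
    by simp
qed

text \<open>Pairs of a scalar and an old vector parametrize the enlarged span. This yields both the
  upper bound on its size and, when the parametrization is injective, the exact size.\<close>

lemma span_insert_image: "span (insert x S) = (\<lambda>(c, s). scale c x + s) ` (UNIV \<times> span S)"
proof (rule set_eqI)
  fix y
  have "y - scale k x \<in> span S \<longleftrightarrow> (\<exists>s\<in>span S. y = scale k x + s)" for k
    by (auto intro: bexI[of _ "y - scale k x"])
  then show "y \<in> span (insert x S) \<longleftrightarrow> y \<in> (\<lambda>(c, s). scale c x + s) ` (UNIV \<times> span S)"
    by (auto simp: span_insert image_iff)
qed

lemma finite_span_insert: "finite (span S) \<Longrightarrow> finite (span (insert x S))"
  by (simp add: span_insert_image)

lemma card_span_insert_le:
  assumes "finite (span S)"
  shows "card (span (insert x S)) \<le> CARD('k) * card (span S)"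
  using card_image_le[of "UNIV \<times> span S" "\<lambda>(c, s). scale c x + s"] assms
  by (simp add: span_insert_image card_cartesian_product)

lemma card_span_insert:
  assumes fin: "finite (span S)" and x: "x \<notin> span S"
  shows "card (span (insert x S)) = CARD('k) * card (span S)"
proof -
  have "inj_on (\<lambda>(c, s). scale c x + s) (UNIV \<times> span S)"
  proof (rule inj_onI, clarify)
    fix c s d t
    assume st: "s \<in> span S" "t \<in> span S" and eq: "scale c x + s = scale d x + t"
    have "scale (c - d) x = t - s"
      using eq by (simp add: scale_left_diff_distrib algebra_simps)
    then have "scale (c - d) x \<in> span S"
      using st by (simp add: span_diff)
    \<comment> \<open>If \<open>c - d\<close> were nonzero, inverting it would put \<open>x\<close>
      into the span.\<close>
    then have "scale (inverse (c - d)) (scale (c - d) x) \<in> span S"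
      by (rule span_scale)
    then have "c = d"
      using x by (cases "c = d") (simp_all only: scale_scale, simp)
    then show "c = d \<and> s = t"
      using eq by simp
  qed
  then show ?thesis
    by (simp add: span_insert_image card_image card_cartesian_product)
qed

text \<open>Independence in the quotient by \<open>span T\<close>, without forming the quotient. The
  head is compared with the tail, so that counting lists is an induction by consing.\<close>

primrec indep_mod :: "'b set \<Rightarrow> 'b list \<Rightarrow> bool" where
  "indep_mod T [] \<longleftrightarrow> True"
| "indep_mod T (x # xs) \<longleftrightarrow> x \<notin> span (T \<union> set xs) \<and> indep_mod T xs"

lemma indep_mod_empty_iff: "indep_mod {} xs \<longleftrightarrow> distinct xs \<and> independent (set xs)"
  by (induction xs) (auto simp: independent_empty independent_insert span_base)

lemma finite_span_Un_set: "finite (span T) \<Longrightarrow> finite (span (T \<union> set xs))"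
  by (induction xs) (auto simp: finite_span_insert)

lemma card_span_Un_set_le:
  assumes "finite (span T)"
  shows "card (span (T \<union> set xs)) \<le> card (span T) * CARD('k) ^ length xs"
proof (induction xs)
  case (Cons x xs)
  have "card (span (T \<union> set (x # xs))) \<le> CARD('k) * card (span (T \<union> set xs))"
    using card_span_insert_le[OF finite_span_Un_set[OF assms]] by simp
  also have "\<dots> \<le> CARD('k) * (card (span T) * CARD('k) ^ length xs)"
    using Cons.IH by simp
  finally show ?case
    by (simp add: mult_ac)
qed simp

lemma card_span_indep_mod:
  assumes "finite (span T)" and "indep_mod T xs"
  shows "card (span (T \<union> set xs)) = card (span T) * CARD('k) ^ length xs"
  using assms(2)
proof (induction xs)
  case (Cons x xs)
  then show ?case
    using card_span_insert[OF finite_span_Un_set[OF assms(1), of xs], of x] by simp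
qed simp

text \<open>Each vector enlarges the span at most by the factor \<open>CARD('k)\<close>, so a span
  of maximal size leaves no room for a dependent vector.\<close>

lemma indep_mod_if_card_span:
  assumes "finite (span T)" and "card (span T) * CARD('k) ^ length xs \<le> card (span (T \<union> set xs))"
  shows "indep_mod T xs"
  using assms(2)
proof (induction xs)
  case (Cons x xs)
  have pos: "0 < card (span T)"
    using assms(1) span_zero by (metis card_gt_0_iff empty_iff)
  have "card (span (T \<union> set (x # xs))) \<le> CARD('k) * card (span (T \<union> set xs))"
    using card_span_insert_le[OF finite_span_Un_set[OF assms(1)]] by simp
  from order_trans[OF Cons.prems this] have "CARD('k) * (card (span T) * CARD('k) ^ length xs) \<le> CARD('k) * card (span (T \<union> set xs))"
    by (simp only: length_Cons power_Suc mult_ac)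
  then have le: "card (span T) * CARD('k) ^ length xs \<le> card (span (T \<union> set xs))"
    by (subst (asm) mult_le_cancel1) auto
  have "x \<notin> span (T \<union> set xs)"
  proof
    assume "x \<in> span (T \<union> set xs)"
    then have "card (span (T \<union> set (x # xs))) = card (span (T \<union> set xs))"
      by (simp add: span_redundant)
    then have "card (span T) * CARD('k) ^ length (x # xs) \<le> card (span T) * CARD('k) ^ length xs"
      using Cons.prems card_span_Un_set_le[OF assms(1), of xs] by linarith
    then have "CARD('k) * (card (span T) * CARD('k) ^ length xs) \<le> 1 * (card (span T) * CARD('k) ^ length xs)"
      by (simp only: length_Cons power_Suc mult_1 mult_ac)
    then show False
      using pos card_scalars_gt_1 by (subst (asm) mult_le_cancel2) auto
  qed
  then show ?case
    using Cons.IH[OF le] by simp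
qed simp

text \<open>The size of \<open>span (T \<union> set xs)\<close> depends only on the length of
  \<open>xs\<close>, so all independent lists of the same length have equally many extensions. Once
  the span exhausts \<open>V\<close>, the factor is 0, which agrees with the truncated
  subtraction.\<close>

lemma card_indep_mod_lists:
  assumes V: "subspace V" "finite V" and T: "T \<subseteq> V"
  shows "card {xs. length xs = s \<and> set xs \<subseteq> V \<and> indep_mod T xs} =
           (\<Prod>l<s. card V - card (span T) * CARD('k) ^ l)"
proof (induction s)
  case 0
  have "{xs. length xs = 0 \<and> set xs \<subseteq> V \<and> indep_mod T xs} = {[]}"
    by auto
  then show ?case
    by simp
next
  case (Suc s)
  let ?L = "\<lambda>s. {xs. length xs = s \<and> set xs \<subseteq> V \<and> indep_mod T xs}"
  have finT: "finite (span T)"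
    using span_minimal[OF T V(1)] V(2) finite_subset by blast
  have eq: "?L (Suc s) = (\<lambda>(xs, x). x # xs) ` (SIGMA xs:?L s. V - span (T \<union> set xs))"
    by (force simp: image_iff length_Suc_conv)
  have fin: "finite (?L s)"
    using finite_lists_length_eq[OF V(2), of s] by (rule rev_finite_subset) auto
  have "card (?L (Suc s)) = card (SIGMA xs:?L s. V - span (T \<union> set xs))"
    unfolding eq by (rule card_image) (auto simp: inj_on_def)
  also have "\<dots> = (\<Sum>xs\<in>?L s. card (V - span (T \<union> set xs)))"
    using fin V(2) by (intro card_SigmaI) auto
  also have "\<dots> = (\<Sum>xs\<in>?L s. card V - card (span T) * CARD('k) ^ s)"
  proof (rule sum.cong[OF refl])
    fix xs assume xs: "xs \<in> ?L s"
    then have "span (T \<union> set xs) \<subseteq> V"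
      using T V(1) by (intro span_minimal) auto
    then show "card (V - span (T \<union> set xs)) = card V - card (span T) * CARD('k) ^ s"
      using xs card_span_indep_mod[OF finT, of xs] finite_span_Un_set[OF finT, of xs]
      by (simp add: card_Diff_subset)
  qed
  finally show ?case
    using Suc.IH by simp
qed

lemma finite_indep_mod_lists: "finite V \<Longrightarrow> finite {xs. length xs = s \<and> set xs \<subseteq> V \<and> indep_mod T xs}"
  using finite_lists_length_eq[of V s] by (rule rev_finite_subset) auto

lemma subspace_basis_list:
  assumes "subspace S" "finite S"
  obtains xs where "length xs = dim S" "set xs \<subseteq> S" "indep_mod {} xs" "span (set xs) = S"
proof -
  obtain B where B: "B \<subseteq> S" "independent B" "S \<subseteq> span B" "card B = dim S"
    using basis_exists[of S] by metis
  have "finite B"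
    using B(1) assms(2) finite_subset by blast
  then obtain xs where xs: "set xs = B" "distinct xs"
    using finite_distinct_list by blast
  have "span (set xs) = S"
    using B xs span_minimal[OF B(1) assms(1)] by auto
  then show thesis
    using that[of xs] B xs distinct_card[of xs] by (simp add: indep_mod_empty_iff)
qed

lemma card_subspace:
  assumes "subspace S" "finite S"
  shows "card S = CARD('k) ^ dim S"
proof -
  obtain xs where "length xs = dim S" "indep_mod {} xs" "span (set xs) = S"
    using subspace_basis_list[OF assms] .
  then show ?thesis
    using card_span_indep_mod[of "{}" xs] by (simp add: span_empty)
qed

lemma dim_eq_iff_card:
  assumes "subspace S" "finite S"
  shows "dim S = b \<longleftrightarrow> card S = CARD('k) ^ b"
  using card_subspace[OF assms] card_scalars_gt_1 by simp

section \<open>Counting subspaces by their ordered bases\<close>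

lemma prod_power_diff_pos: "0 < (\<Prod>l<b. CARD('k) ^ b - CARD('k) ^ l)"
  using card_scalars_gt_1 by (intro prod_pos) auto

lemma subspace_eq_if_card:
  assumes "subspace S" "finite S" "set xs \<subseteq> S" "T \<subseteq> S" "indep_mod T xs"
    and "card S = card (span T) * CARD('k) ^ length xs"
  shows "span (T \<union> set xs) = S"
proof (rule card_subset_eq)
  show "span (T \<union> set xs) \<subseteq> S"
    using assms by (intro span_minimal) auto
  have "finite (span T)"
    using span_minimal[OF assms(4,1)] assms(2) finite_subset by blast
  then show "card (span (T \<union> set xs)) = card S"
    using card_span_indep_mod assms(5,6) by simp
qed (fact assms)

text \<open>Double counting: every independent list of length \<open>b\<close> in \<open>V\<close>
  spans exactly one subspace of dimension \<open>b\<close>, and all these subspaces have equally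
  many ordered bases. The product form avoids a division in \<open>nat\<close>.\<close>

lemma card_subspaces_mult:
  assumes V: "subspace V" "finite V" "card V = CARD('k) ^ a"
  shows "card {S. subspace S \<and> S \<subseteq> V \<and> dim S = b} * (\<Prod>l<b. CARD('k) ^ b - CARD('k) ^ l) =
           (\<Prod>l<b. CARD('k) ^ a - CARD('k) ^ l)"
proof -
  let ?\<S> = "{S. subspace S \<and> S \<subseteq> V \<and> dim S = b}"
  let ?L = "\<lambda>S. {xs. length xs = b \<and> set xs \<subseteq> S \<and> indep_mod {} xs}"
  have fin: "finite ?\<S>"
    by (rule finite_subset[of _ "Pow V"]) (use V in auto)
  have finS: "finite S" and cardS: "card S = CARD('k) ^ b" if "S \<in> ?\<S>" for S
  proof -
    show "finite S"
      using that finite_subset[OF _ V(2)] by blast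
    then show "card S = CARD('k) ^ b"
      using that card_subspace by auto
  qed
  have sp: "span (set xs) = S" if "S \<in> ?\<S>" "xs \<in> ?L S" for S xs
    using subspace_eq_if_card[of S xs "{}"] that finS[OF that(1)] cardS[OF that(1)]
    by (simp add: span_empty)
  have "?L V = (\<Union>S\<in>?\<S>. ?L S)"
  proof (rule set_eqI, rule iffI)
    fix xs assume xs: "xs \<in> ?L V"
    have sub: "span (set xs) \<subseteq> V"
      using xs V(1) by (intro span_minimal) auto
    have "card (span (set xs)) = CARD('k) ^ b"
      using xs card_span_indep_mod[of "{}" xs] by (simp add: span_empty)
    then have "dim (span (set xs)) = b"
      using dim_eq_iff_card[OF subspace_span, of "set xs"] sub V(2) finite_subset by blast
    then show "xs \<in> (\<Union>S\<in>?\<S>. ?L S)"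
      using xs sub by (auto intro!: exI[of _ "span (set xs)"] span_base)
  qed auto
  then have "card (?L V) = card (\<Union>S\<in>?\<S>. ?L S)"
    by simp
  also have "\<dots> = (\<Sum>S\<in>?\<S>. card (?L S))"
  proof (rule card_UN_disjoint[OF fin])
    show "\<forall>S\<in>?\<S>. finite (?L S)"
      using finS finite_indep_mod_lists by blast
    show "\<forall>S\<in>?\<S>. \<forall>S'\<in>?\<S>. S \<noteq> S' \<longrightarrow> ?L S \<inter> ?L S' = {}"
      using sp by blast
  qed
  also have "\<dots> = (\<Sum>S\<in>?\<S>. \<Prod>l<b. CARD('k) ^ b - CARD('k) ^ l)"
  proof (rule sum.cong[OF refl])
    fix S assume S: "S \<in> ?\<S>"
    then show "card (?L S) = (\<Prod>l<b. CARD('k) ^ b - CARD('k) ^ l)"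
      using card_indep_mod_lists[of S "{}" b] finS[OF S] cardS[OF S] by (simp add: span_empty)
  qed
  finally show ?thesis
    using card_indep_mod_lists[OF V(1,2), of "{}" b] V(3) by (simp add: span_empty)
qed

text \<open>The lists that complete \<open>T\<close> to \<open>U\<close> are disjoint for different
  \<open>U\<close>, and because \<open>U\<close> meets \<open>R\<close> only in \<open>T\<close>,
  they stay independent modulo the larger space \<open>R\<close>. So they are among the lists in
  \<open>V\<close> independent modulo \<open>R\<close>.\<close>

lemma card_subspaces_Int_eq_mult_le:
  assumes V: "finite V" and R: "subspace R" "R \<subseteq> V" and T: "subspace T" "T \<subseteq> R" and sV: "subspace V"
  shows "card {U. subspace U \<and> U \<subseteq> V \<and> U \<inter> R = T \<and> card U = card T * CARD('k) ^ s} *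
           (\<Prod>l<s. card T * CARD('k) ^ s - card T * CARD('k) ^ l) \<le>
         (\<Prod>l<s. card V - card R * CARD('k) ^ l)"
proof -
  let ?\<S> = "{U. subspace U \<and> U \<subseteq> V \<and> U \<inter> R = T \<and> card U = card T * CARD('k) ^ s}"
  let ?L = "\<lambda>T U. {xs. length xs = s \<and> set xs \<subseteq> U \<and> indep_mod T xs}"
  have fin: "finite ?\<S>"
    by (rule finite_subset[of _ "Pow V"]) (use V in auto)
  have finS: "finite S" if "S \<in> ?\<S>" for S
    using that finite_subset[OF _ V] by blast
  have spT: "span T = T" and spR: "span R = R"
    using T R by (auto simp: span_eq_iff)
  have sp: "span (T \<union> set xs) = U" if "U \<in> ?\<S>" "xs \<in> ?L T U" for U xs
    using subspace_eq_if_card[of U xs T] that finS[OF that(1)] spT by auto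
  have indep_R: "indep_mod R xs" if U: "subspace U" "U \<inter> R = T" and xs: "set xs \<subseteq> U" "indep_mod T xs" for U xs
    using xs
  proof (induction xs)
    case (Cons x xs)
    have "x \<notin> span (R \<union> set xs)"
    proof
      assume "x \<in> span (R \<union> set xs)"
      \<comment> \<open>The component \<open>r\<close> is a difference of vectors of
        \<open>U\<close>, hence lies in \<open>U \<inter> R = T\<close>, and the dependence modulo
        \<open>R\<close> is already one modulo \<open>T\<close>.\<close>
      then obtain r y where ry: "x = r + y" "r \<in> R" "y \<in> span (set xs)"
        unfolding span_Un spR by auto
      have "y \<in> U"
        using ry(3) span_minimal[of "set xs" U] Cons.prems U(1) by auto
      then have "r \<in> U"
        using ry(1) Cons.prems U(1) subspace_diff[of U x y] by simp
      then have "r \<in> T"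
        using ry U by auto
      then have "x \<in> span (T \<union> set xs)"
        unfolding ry(1) using ry(3)
        by (intro span_add) (auto intro: span_base span_mono[THEN subsetD])
      then show False
        using Cons.prems by simp
    qed
    then show ?case
      using Cons by simp
  qed simp
  have "card ?\<S> * (\<Prod>l<s. card T * CARD('k) ^ s - card T * CARD('k) ^ l) = (\<Sum>U\<in>?\<S>. card (?L T U))"
  proof -
    have "card (?L T U) = (\<Prod>l<s. card T * CARD('k) ^ s - card T * CARD('k) ^ l)" if U: "U \<in> ?\<S>" for U
      using card_indep_mod_lists[of U T s] U finS[OF U] spT by auto
    then show ?thesis
      by simp
  qed
  also have "\<dots> = card (\<Union>U\<in>?\<S>. ?L T U)"
  proof (rule card_UN_disjoint[OF fin, symmetric])
    show "\<forall>S\<in>?\<S>. finite (?L T S)"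
      using finS finite_indep_mod_lists by blast
    show "\<forall>S\<in>?\<S>. \<forall>S'\<in>?\<S>. S \<noteq> S' \<longrightarrow> ?L T S \<inter> ?L T S' = {}"
    proof (intro ballI impI, rule ccontr)
      fix S S' assume S: "S \<in> ?\<S>" "S' \<in> ?\<S>" "S \<noteq> S'" and "?L T S \<inter> ?L T S' \<noteq> {}"
      then obtain xs where "xs \<in> ?L T S" "xs \<in> ?L T S'"
        by blast
      then have "S = S'"
        using sp[OF S(1)] sp[OF S(2)] by metis
      then show False
        using S(3) by contradiction
    qed
  qed
  also have "\<dots> \<le> card (?L R V)"
    using indep_R by (intro card_mono finite_indep_mod_lists[OF V]) blast
  also have "\<dots> = (\<Prod>l<s. card V - card R * CARD('k) ^ l)"
    using card_indep_mod_lists[OF sV V R(2)] spR by simp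
  finally show ?thesis .
qed

end

section \<open>Gaussian binomial coefficients\<close>

lemma card_coord_space: "card (coord_space a :: (nat \<Rightarrow> 'k::{field,finite}) set) = CARD('k) ^ a"
  and finite_coord_space: "finite (coord_space a :: (nat \<Rightarrow> 'k) set)"
proof -
  have "bij_betw (\<lambda>f. restrict f {..<a}) (coord_space a :: (nat \<Rightarrow> 'k) set) ({..<a} \<rightarrow>\<^sub>E UNIV)"
    by (rule bij_betw_byWitness[where f' = "\<lambda>f i. if i < a then f i else 0"])
      (auto simp: coord_space_def fun_eq_iff PiE_def extensional_def)
  then show "card (coord_space a :: (nat \<Rightarrow> 'k) set) = CARD('k) ^ a"
    "finite (coord_space a :: (nat \<Rightarrow> 'k) set)"
    by (simp_all add: bij_betw_same_card bij_betw_finite card_PiE finite_PiE)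
qed

context finite_field_space
begin

lemma gauss_binomial_mult:
  "gauss_binomial TYPE('k) a b * (\<Prod>l<b. CARD('k) ^ b - CARD('k) ^ l) =
     (\<Prod>l<b. CARD('k) ^ a - CARD('k) ^ l)"
proof -
  interpret F: finite_field_space "fun_scale :: 'k \<Rightarrow> (nat \<Rightarrow> 'k) \<Rightarrow> _"
    by (simp add: finite_field_space_def vector_space_fun_scale)
  have "F.subspace (coord_space a)"
    by (auto simp: F.subspace_def coord_space_def fun_scale_def)
  then show ?thesis
    unfolding gauss_binomial_def
    by (rule F.card_subspaces_mult[OF _ finite_coord_space card_coord_space])
qed

lemma gauss_binomial_pos:
  assumes "b \<le> a"
  shows "0 < gauss_binomial TYPE('k) a b"
proof (rule ccontr)
  assume "\<not> 0 < gauss_binomial TYPE('k) a b"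
  then have "(\<Prod>l<b. CARD('k) ^ a - CARD('k) ^ l) = 0"
    using gauss_binomial_mult[of a b] by simp
  \<comment> \<open>The subtraction is truncated, so a vanishing factor only gives an inequality of
    powers.\<close>
  then obtain l where "l < b" "CARD('k) ^ a \<le> CARD('k) ^ l"
    by (auto simp: prod_zero_iff)
  then show False
    using assms card_scalars_gt_1 by simp
qed

text \<open>The coefficient counts subspaces of one concrete coordinate space. Any space of the same
  size satisfies the same product identity, and the common positive factor cancels.\<close>

lemma card_subspaces:
  assumes "subspace V" "finite V" "card V = CARD('k) ^ a"
  shows "card {S. subspace S \<and> S \<subseteq> V \<and> dim S = b} = gauss_binomial TYPE('k) a b"
proof -
  have "card {S. subspace S \<and> S \<subseteq> V \<and> dim S = b} * (\<Prod>l<b. CARD('k) ^ b - CARD('k) ^ l) =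
      gauss_binomial TYPE('k) a b * (\<Prod>l<b. CARD('k) ^ b - CARD('k) ^ l)"
    using card_subspaces_mult[OF assms, of b] gauss_binomial_mult[of a b] by (rule trans[OF _ sym])
  then show ?thesis
    using prod_power_diff_pos[of b] by (subst (asm) mult_cancel2) linarith
qed

text \<open>Take \<open>CARD('k) ^ i\<close> out of each factor on the left of the product bound and
  \<open>CARD('k) ^ j\<close> out of each factor on the right. What remains on the right is the
  product for a Gaussian binomial with upper entry \<open>a - j\<close>; the surplus powers give the
  exponent \<open>(j - i) * s\<close>.\<close>

lemma card_subspaces_Int_eq_le:
  assumes V: "subspace V" "finite V" "card V = CARD('k) ^ a"
    and R: "subspace R" "R \<subseteq> V" "card R = CARD('k) ^ j" and T: "subspace T" "T \<subseteq> R" "card T = CARD('k) ^ i"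
  shows "card {U. subspace U \<and> U \<subseteq> V \<and> U \<inter> R = T \<and> card U = CARD('k) ^ (i + s)} \<le>
           gauss_binomial TYPE('k) (a - j) s * CARD('k) ^ ((j - i) * s)" (is "?X \<le> _")
proof -
  let ?q = "CARD('k)"
  let ?N = "\<Prod>l<s. ?q ^ s - ?q ^ l"
  have "?q ^ j \<le> ?q ^ a"
    using card_mono[OF V(2) R(2)] R(3) V(3) by simp
  then have ja: "j \<le> a"
    using card_scalars_gt_1 by simp
  have "?q ^ i \<le> ?q ^ j"
    using card_mono[OF finite_subset[OF R(2) V(2)] T(2)] R(3) T(3) by simp
  then have ij: "i \<le> j"
    using card_scalars_gt_1 by simp
  have "?X * (\<Prod>l<s. ?q ^ i * ?q ^ s - ?q ^ i * ?q ^ l) \<le> (\<Prod>l<s. ?q ^ a - ?q ^ j * ?q ^ l)"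
    using card_subspaces_Int_eq_mult_le[OF V(2) R(1,2) T(1,2) V(1), of s] V(3) R(3) T(3)
    by (simp add: power_add)
  moreover have "(\<Prod>l<s. ?q ^ i * ?q ^ s - ?q ^ i * ?q ^ l) = ?q ^ (i * s) * ?N"
    by (simp add: diff_mult_distrib2[symmetric] prod.distrib power_mult)
  moreover have "(\<Prod>l<s. ?q ^ a - ?q ^ j * ?q ^ l) = ?q ^ (j * s) * (\<Prod>l<s. ?q ^ (a - j) - ?q ^ l)"
  proof -
    have "?q ^ a = ?q ^ j * ?q ^ (a - j)"
      using ja by (simp add: power_add[symmetric])
    then show ?thesis
      by (simp add: diff_mult_distrib2[symmetric] prod.distrib power_mult)
  qed
  moreover have "(\<Prod>l<s. ?q ^ (a - j) - ?q ^ l) = gauss_binomial TYPE('k) (a - j) s * ?N"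
    using gauss_binomial_mult[of "a - j" s] by simp
  moreover have "?q ^ (j * s) = ?q ^ (i * s) * ?q ^ ((j - i) * s)"
    using ij by (simp add: power_add[symmetric] add_mult_distrib[symmetric])
  ultimately have "(?X) * (?q ^ (i * s) * ?N) \<le>
      (gauss_binomial TYPE('k) (a - j) s * ?q ^ ((j - i) * s)) * (?q ^ (i * s) * ?N)"
    by (simp add: mult_ac)
  then show ?thesis
    using prod_power_diff_pos[of s] by (subst (asm) mult_le_cancel2) auto
qed

text \<open>Sort the subspaces \<open>U\<close> by their intersection \<open>T\<close> with
  \<open>R\<close>. The middle coefficient counts the possible \<open>T\<close>, the other two
  factors bound the \<open>U\<close> for one \<open>T\<close>.\<close>

lemma card_subspaces_dim_Int_le:
  assumes V: "subspace V" "finite V" "card V = CARD('k) ^ a"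
    and R: "subspace R" "R \<subseteq> V" "dim R = j" and i: "i \<le> d"
  shows "card {U. subspace U \<and> U \<subseteq> V \<and> dim U = d \<and> dim (U \<inter> R) = i} \<le>
     gauss_binomial TYPE('k) (a - j) (d - i) * gauss_binomial TYPE('k) j i * CARD('k) ^ ((j - i) * (d - i))"
proof -
  let ?\<T> = "{T. subspace T \<and> T \<subseteq> R \<and> dim T = i}"
  let ?X = "\<lambda>T. {U. subspace U \<and> U \<subseteq> V \<and> U \<inter> R = T \<and> card U = CARD('k) ^ (i + (d - i))}"
  have finR: "finite R"
    using R(2) V(2) finite_subset by blast
  have cR: "card R = CARD('k) ^ j"
    using card_subspace[OF R(1) finR] R(3) by simp
  have finX: "finite (?X T)" for T
    by (rule finite_subset[of _ "Pow V"]) (use V in auto)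
  have finT: "finite ?\<T>"
    by (rule finite_subset[of _ "Pow R"]) (use finR in auto)
  have "card {U. subspace U \<and> U \<subseteq> V \<and> dim U = d \<and> dim (U \<inter> R) = i} \<le> card (\<Union>T\<in>?\<T>. ?X T)"
  proof (rule card_mono)
    show "{U. subspace U \<and> U \<subseteq> V \<and> dim U = d \<and> dim (U \<inter> R) = i} \<subseteq> (\<Union>T\<in>?\<T>. ?X T)"
      using i R(1) finite_subset[OF _ V(2)] by (auto simp: card_subspace subspace_inter)
  qed (use finT finX in auto)
  also have "\<dots> \<le> (\<Sum>T\<in>?\<T>. card (?X T))"
    by (rule card_UN_le[OF finT])
  also have "\<dots> \<le> (\<Sum>T\<in>?\<T>. gauss_binomial TYPE('k) (a - j) (d - i) * CARD('k) ^ ((j - i) * (d - i)))"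
  proof (rule sum_mono)
    fix T assume T: "T \<in> ?\<T>"
    then have "card T = CARD('k) ^ i"
      using card_subspace[of T] finite_subset[OF _ finR, of T] by auto
    then show "card (?X T) \<le> gauss_binomial TYPE('k) (a - j) (d - i) * CARD('k) ^ ((j - i) * (d - i))"
      using card_subspaces_Int_eq_le[OF V R(1,2) cR] T by blast
  qed
  also have "\<dots> = gauss_binomial TYPE('k) (a - j) (d - i) * gauss_binomial TYPE('k) j i * CARD('k) ^ ((j - i) * (d - i))"
    using card_subspaces[OF R(1) finR cR, of i] by simp
  finally show ?thesis .
qed

end

section \<open>Row spaces and rank\<close>

interpretation coords: finite_field_space "(*s) :: 'k::{field,finite} \<Rightarrow> 'k ^ 'n \<Rightarrow> 'k ^ 'n"
  by unfold_locales

text \<open>Both images correspond to the common fibres. This lets row vectors be counted through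
  restrictions of functionals to a basis.\<close>

lemma card_image_eq_if_same_fibres:
  assumes "\<And>x y. x \<in> A \<Longrightarrow> y \<in> A \<Longrightarrow> f x = f y \<longleftrightarrow> g x = g y"
  shows "card (f ` A) = card (g ` A)"
proof (rule bij_betw_same_card)
  have *: "g (inv_into A f (f x)) = g x" if "x \<in> A" for x
    using assms[of "inv_into A f (f x)" x] that by (simp add: inv_into_into f_inv_into_f)
  show "bij_betw (\<lambda>y. g (inv_into A f y)) (f ` A) (g ` A)"
    unfolding bij_betw_def
  proof
    show "inj_on (\<lambda>y. g (inv_into A f y)) (f ` A)"
      by (rule inj_onI) (auto simp: * assms)
    show "(\<lambda>y. g (inv_into A f y)) ` f ` A = g ` A"
      by (simp add: image_image * cong: image_cong)
  qed
qed

locale field_extension =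
  fixes emb :: "'k::{field,finite} \<Rightarrow> 'a::{field,finite}"
  assumes emb: "field_embedding emb"
begin

sublocale E: finite_field_space "ext_scale emb"
  by (simp add: finite_field_space_def emb vector_space_ext_scale)

section \<open>Row spaces through linear functionals\<close>

sublocale dual: vector_space_pair "ext_scale emb" "(*) :: 'k \<Rightarrow> 'k \<Rightarrow> 'k" ..

abbreviation functional :: "('a \<Rightarrow> 'k) \<Rightarrow> bool" where
  "functional \<equiv> Vector_Spaces.linear (ext_scale emb) (*)"

lemma functional_add: "functional \<phi> \<Longrightarrow> \<phi> (x + y) = \<phi> x + \<phi> y"
  and functional_emb_mult: "functional \<phi> \<Longrightarrow> \<phi> (emb c * x) = c * \<phi> x"
  using dual.linear_add[of \<phi> x y] dual.linear_scale[of \<phi> c x] by (simp_all add: ext_scale_def)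

text \<open>
  Expanding the entries of \<open>x\<close> in a basis of the extension amounts to applying the coordinate
  functionals, so the row space of the expanded matrix consists of all images of \<open>x\<close> under
  functionals.
\<close>

definition expanded_row_space :: "'a ^ 'n \<Rightarrow> ('k ^ 'n) set" where
  "expanded_row_space x = (\<lambda>\<phi>. \<chi> j. \<phi> (x $ j)) ` Collect functional"

lemma subspace_expanded_row_space: "vec.subspace (expanded_row_space x)"
proof (rule vec.subspaceI)
  have "functional (\<lambda>_. 0)"
    by (rule dual.linear_zero)
  then show "0 \<in> expanded_row_space x"
    by (force simp: expanded_row_space_def vec_eq_iff)
next
  fix u v assume "u \<in> expanded_row_space x" "v \<in> expanded_row_space x"
  then obtain \<phi> \<psi> where *: "functional \<phi>" "functional \<psi>" "u = (\<chi> j. \<phi> (x $ j))" "v = (\<chi> j. \<psi> (x $ j))"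
    by (auto simp: expanded_row_space_def)
  then have "functional (\<lambda>y. \<phi> y + \<psi> y)"
    by (intro dual.linear_compose_add)
  moreover have "u + v = (\<chi> j. \<phi> (x $ j) + \<psi> (x $ j))"
    by (simp add: * vec_eq_iff)
  ultimately show "u + v \<in> expanded_row_space x"
    by (auto simp: expanded_row_space_def)
next
  fix c u assume "u \<in> expanded_row_space x"
  then obtain \<phi> where *: "functional \<phi>" "u = (\<chi> j. \<phi> (x $ j))"
    by (auto simp: expanded_row_space_def)
  then have "functional (\<lambda>y. c * \<phi> y)"
    by (intro dual.linear_compose_scale_right)
  moreover have "c *s u = (\<chi> j. c * \<phi> (x $ j))"
    by (simp add: * vec_eq_iff)
  ultimately show "c *s u \<in> expanded_row_space x"
    by (auto simp: expanded_row_space_def)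
qed

text \<open>Row rank equals column rank: a row vector is determined by the values of its functional
  on a basis of the span of the entries, and these values are arbitrary. Hence there are
  \<open>CARD('k) ^ rk emb x\<close> row vectors.\<close>

lemma dim_expanded_row_space: "vec.dim (expanded_row_space x) = rk emb x"
proof -
  let ?W = "E.span (range (\<lambda>j. x $ j))"
  obtain B where B: "B \<subseteq> ?W" "E.independent B" "?W \<subseteq> E.span B" "card B = E.dim ?W"
    using E.basis_exists[of ?W] by metis
  have fibres: "(\<chi> j. \<phi> (x $ j)) = (\<chi> j. \<psi> (x $ j)) \<longleftrightarrow> restrict \<phi> B = restrict \<psi> B"
    if "functional \<phi>" "functional \<psi>" for \<phi> \<psi>
  proof
    assume "(\<chi> j. \<phi> (x $ j)) = (\<chi> j. \<psi> (x $ j))"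
    then have eq: "\<phi> y = \<psi> y" if "y \<in> range (\<lambda>j. x $ j)" for y
      using that by (auto simp: vec_eq_iff)
    have "\<phi> b = \<psi> b" if "b \<in> B" for b
      by (rule dual.linear_eq_on[OF \<open>functional \<phi>\<close> \<open>functional \<psi>\<close> subsetD[OF B(1) that] eq])
    then show "restrict \<phi> B = restrict \<psi> B"
      by (auto simp: restrict_def)
  next
    assume "restrict \<phi> B = restrict \<psi> B"
    then have eq: "\<phi> y = \<psi> y" if "y \<in> B" for y
      using that by (metis restrict_apply')
    have "\<phi> (x $ j) = \<psi> (x $ j)" for j
    proof (rule dual.linear_eq_on[OF \<open>functional \<phi>\<close> \<open>functional \<psi>\<close> _ eq])
      show "x $ j \<in> E.span B"
        by (rule subsetD[OF B(3)], rule E.span_base) simp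
    qed
    then show "(\<chi> j. \<phi> (x $ j)) = (\<chi> j. \<psi> (x $ j))"
      by simp
  qed
  have "card (expanded_row_space x) = card ((\<lambda>\<phi>. restrict \<phi> B) ` Collect functional)"
    unfolding expanded_row_space_def by (rule card_image_eq_if_same_fibres) (rule fibres, simp_all)
  also have "(\<lambda>\<phi>. restrict \<phi> B) ` Collect functional = B \<rightarrow>\<^sub>E UNIV"
  proof
    show "B \<rightarrow>\<^sub>E UNIV \<subseteq> (\<lambda>\<phi>. restrict \<phi> B) ` Collect functional"
    proof
      fix f :: "'a \<Rightarrow> 'k" assume f: "f \<in> B \<rightarrow>\<^sub>E UNIV"
      obtain \<phi> where "functional \<phi>" "\<forall>b\<in>B. \<phi> b = f b"
        using dual.linear_independent_extend[OF B(2), of f] by blast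
      moreover from this have "f = restrict \<phi> B"
        using f by (auto simp: fun_eq_iff restrict_def PiE_def extensional_def)
      ultimately show "f \<in> (\<lambda>\<phi>. restrict \<phi> B) ` Collect functional"
        by blast
    qed
  qed auto
  also have "card (B \<rightarrow>\<^sub>E (UNIV :: 'k set)) = CARD('k) ^ rk emb x"
    using B(4) by (simp add: card_PiE rk_def)
  finally show ?thesis
    by (subst coords.dim_eq_iff_card) (auto simp: subspace_expanded_row_space)
qed

text \<open>The entries of \<open>B\<close> are base field scalars and pass through a functional
  \<phi>, so the image is the combination of the rows with coefficients
  \<open>\<phi> (a i)\<close>.\<close>

lemma expanded_row_space_vec_mat_mult: "expanded_row_space (vec_mat_mult emb \<delta> a B) \<subseteq> row_space \<delta> B"
proof
  fix u assume "u \<in> expanded_row_space (vec_mat_mult emb \<delta> a B)"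
  then obtain \<phi> where \<phi>: "functional \<phi>" "u = (\<chi> j. \<phi> (vec_mat_mult emb \<delta> a B $ j))"
    by (auto simp: expanded_row_space_def)
  have "\<phi> (vec_mat_mult emb \<delta> a B $ j) = (\<Sum>i<\<delta>. \<phi> (a i) *s B i) $ j" for j
    using functional_emb_mult[OF \<phi>(1)]
    by (simp add: vec_mat_mult_def dual.linear_sum[OF \<phi>(1)] mult.commute)
  then have "u = (\<Sum>i<\<delta>. \<phi> (a i) *s B i)"
    by (simp add: \<phi>(2) vec_eq_iff)
  then show "u \<in> row_space \<delta> B"
    by (simp only: row_space_def) (intro vec.span_sum vec.span_scale vec.span_base imageI)
qed

text \<open>Modulo the row space of \<open>B\<close>, the rows of \<open>e\<close> and of
  \<open>e\<close> minus the product agree. Comparing the dimensions of the two sums links the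
  residual rank of the decoder to \<epsilon>.\<close>

lemma rk_le_rk_diff_plus_dim_Int:
  "rk emb e \<le> rk emb (e - vec_mat_mult emb \<delta> a B) + vec.dim (row_space \<delta> B \<inter> expanded_row_space e)"
proof -
  let ?y = "e - vec_mat_mult emb \<delta> a B" and ?U = "row_space \<delta> B"
  let ?S = "{u + v |u v. u \<in> expanded_row_space e \<and> v \<in> ?U}"
  let ?T = "{u + v |u v. u \<in> expanded_row_space ?y \<and> v \<in> ?U}"
  have U: "vec.subspace ?U"
    by (simp add: row_space_def)
  have "?S \<subseteq> ?T"
  proof clarify
    fix u v assume u: "u \<in> expanded_row_space e" and v: "v \<in> ?U"
    obtain \<phi> where \<phi>: "functional \<phi>" "u = (\<chi> j. \<phi> (e $ j))"
      using u by (auto simp: expanded_row_space_def)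
    \<comment> \<open>Apply \<phi> separately to the residual and to the erasure part; the latter is
      absorbed by \<open>?U\<close>.\<close>
    let ?u = "\<chi> j. \<phi> (?y $ j)" and ?v = "\<chi> j. \<phi> (vec_mat_mult emb \<delta> a B $ j)"
    have "?u \<in> expanded_row_space ?y" "?v \<in> expanded_row_space (vec_mat_mult emb \<delta> a B)"
      using \<phi>(1) by (auto simp: expanded_row_space_def)
    moreover have "u = ?u + ?v"
      by (simp add: \<phi>(2) vec_eq_iff functional_add[OF \<phi>(1), symmetric])
    moreover have "?v + v \<in> ?U" if "?v \<in> expanded_row_space (vec_mat_mult emb \<delta> a B)"
      using subsetD[OF expanded_row_space_vec_mat_mult that] v by (rule vec.subspace_add[OF U])
    ultimately show "\<exists>u' v'. u + v = u' + v' \<and> u' \<in> expanded_row_space ?y \<and> v' \<in> ?U"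
      by (intro exI[of _ ?u] exI[of _ "?v + v"]) (simp add: add.assoc)
  qed
  then have "vec.dim ?S \<le> vec.dim ?T"
    by (rule vec.dim_subset)
  moreover have "vec.dim ?S + vec.dim (expanded_row_space e \<inter> ?U) = rk emb e + vec.dim ?U"
    using vec.dim_sums_Int[OF subspace_expanded_row_space U] by (simp add: dim_expanded_row_space)
  moreover have "vec.dim ?T + vec.dim (expanded_row_space ?y \<inter> ?U) = rk emb ?y + vec.dim ?U"
    using vec.dim_sums_Int[OF subspace_expanded_row_space U] by (simp add: dim_expanded_row_space)
  ultimately show ?thesis
    by (simp add: Int_commute)
qed

text \<open>
  A vector of rank \<open>j\<close> together with an ordered basis of the span of its entries is determined
  by that basis and the \<open>j\<close> linearly independent coordinate vectors.
\<close>

lemma card_rk_eq_mult_le: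
  "card {e :: 'a ^ 'n. rk emb e = j} * (\<Prod>l<j. CARD('k) ^ j - CARD('k) ^ l) \<le>
     (\<Prod>l<j. CARD('a) - CARD('k) ^ l) * (\<Prod>l<j. CARD('k) ^ CARD('n) - CARD('k) ^ l)"
proof -
  let ?R = "{e :: 'a ^ 'n. rk emb e = j}"
  let ?L = "\<lambda>W. {xs. length xs = j \<and> set xs \<subseteq> W \<and> E.indep_mod {} xs}"
  let ?M = "{bs :: ('k ^ 'n) list. length bs = j \<and> set bs \<subseteq> UNIV \<and> coords.indep_mod {} bs}"
  let ?W = "\<lambda>e :: 'a ^ 'n. E.span (range (\<lambda>i. e $ i))"
  \<comment> \<open>For each basis vector \<open>v\<close>, the vector of coefficients at
    \<open>v\<close> of all entries of \<open>e\<close>.\<close>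
  let ?B = "\<lambda>(e :: 'a ^ 'n) xs. map (\<lambda>v. \<chi> l. E.representation (set xs) (e $ l) v) xs"
  have expansion: "e $ l = (\<Sum>v\<in>set xs. ext_scale emb (E.representation (set xs) (e $ l) v) v)"
    if e: "e \<in> ?R" and xs: "xs \<in> ?L (?W e)" for e :: "'a ^ 'n" and xs l
  proof -
    have "card (?W e) = CARD('k) ^ j"
      using e E.card_subspace[of "?W e"] by (simp add: rk_def)
    then have "E.span (set xs) = ?W e"
      using xs E.subspace_eq_if_card[of "?W e" xs "{}"] by simp
    then have "e $ l \<in> E.span (set xs)"
      by (auto intro: E.span_base)
    moreover have "E.independent (set xs)"
      using xs by (simp add: E.indep_mod_empty_iff)
    ultimately show ?thesis
      by (simp add: E.sum_representation_eq)
  qed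
  have "card ?R * (\<Prod>l<j. CARD('k) ^ j - CARD('k) ^ l) = (\<Sum>e\<in>?R. card (?L (?W e)))"
  proof -
    have "card (?L (?W e)) = (\<Prod>l<j. CARD('k) ^ j - CARD('k) ^ l)" if "e \<in> ?R" for e
      using that E.card_indep_mod_lists[of "?W e" "{}" j] E.card_subspace[of "?W e"]
      by (simp add: rk_def)
    then show ?thesis
      by simp
  qed
  also have "\<dots> = card (SIGMA e:?R. ?L (?W e))"
    by (rule card_SigmaI[symmetric]) (auto intro: E.finite_indep_mod_lists)
  also have "\<dots> \<le> card (?L UNIV \<times> ?M)"
  proof (rule card_inj_on_le)
    show "inj_on (\<lambda>(e, xs). (xs, ?B e xs)) (SIGMA e:?R. ?L (?W e))"
    proof (rule inj_onI)
      fix p p'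
      assume "p \<in> (SIGMA e:?R. ?L (?W e))" "p' \<in> (SIGMA e:?R. ?L (?W e))"
        and "(\<lambda>(e, xs). (xs, ?B e xs)) p = (\<lambda>(e, xs). (xs, ?B e xs)) p'"
      then obtain e e' xs where p: "p = (e, xs)" "p' = (e', xs)"
        and e: "e \<in> ?R" "e' \<in> ?R" "xs \<in> ?L (?W e)" "xs \<in> ?L (?W e')" and eq: "?B e xs = ?B e' xs"
        by (cases p, cases p') simp
      have "E.representation (set xs) (e $ l) v = E.representation (set xs) (e' $ l) v" if "v \<in> set xs" for l v
        using eq that by (simp add: vec_eq_iff)
      then have "e $ l = e' $ l" for l
        by (subst expansion[OF e(1,3)], subst expansion[OF e(2,4)]) simp
      then show "p = p'"
        by (simp add: p vec_eq_iff)
    qed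
    show "(\<lambda>(e, xs). (xs, ?B e xs)) ` (SIGMA e:?R. ?L (?W e)) \<subseteq> ?L UNIV \<times> ?M"
    proof (rule image_subsetI)
      fix p assume "p \<in> (SIGMA e:?R. ?L (?W e))"
      then obtain e xs where p: "p = (e, xs)"
        and e: "j = rk emb e" "set xs \<subseteq> ?W e" "E.indep_mod {} xs" "length xs = rk emb e"
        by auto
      \<comment> \<open>The \<open>j\<close> coordinate vectors span at least the row space, which
        has \<open>CARD('k) ^ j\<close> elements; a span of this size forces them to be
        independent.\<close>
      have "expanded_row_space e \<subseteq> vec.span (set (?B e xs))"
      proof
        fix u assume "u \<in> expanded_row_space e"
        then obtain \<phi> where \<phi>: "functional \<phi>" "u = (\<chi> j. \<phi> (e $ j))"
          by (auto simp: expanded_row_space_def)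
        have "u = (\<Sum>v\<in>set xs. \<phi> v *s (\<chi> l. E.representation (set xs) (e $ l) v))"
        proof (subst vec_eq_iff, rule allI)
          fix l
          have "\<phi> (e $ l) = \<phi> (\<Sum>v\<in>set xs. ext_scale emb (E.representation (set xs) (e $ l) v) v)"
            using expansion[of e xs l] e by simp
          then show "u $ l = (\<Sum>v\<in>set xs. \<phi> v *s (\<chi> l. E.representation (set xs) (e $ l) v)) $ l"
            by (simp add: \<phi>(2) dual.linear_sum[OF \<phi>(1)] dual.linear_scale[OF \<phi>(1)] mult.commute)
        qed
        also have "\<dots> \<in> vec.span (set (?B e xs))"
          by (intro vec.span_sum vec.span_scale vec.span_base) auto
        finally show "u \<in> vec.span (set (?B e xs))" .
      qed
      then have "card (expanded_row_space e) \<le> card (vec.span (set (?B e xs)))"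
        by (intro card_mono) auto
      then have "coords.indep_mod {} (?B e xs)"
        using coords.card_subspace[OF subspace_expanded_row_space, of e] e(4)
        by (intro coords.indep_mod_if_card_span) (auto simp: dim_expanded_row_space)
      then show "(\<lambda>(e, xs). (xs, ?B e xs)) p \<in> ?L UNIV \<times> ?M"
        using e p by simp
    qed
    show "finite (?L UNIV \<times> ?M)"
      by (intro finite_cartesian_product E.finite_indep_mod_lists coords.finite_indep_mod_lists) auto
  qed
  also have "\<dots> = (\<Prod>l<j. CARD('a) - CARD('k) ^ l) * (\<Prod>l<j. CARD('k) ^ CARD('n) - CARD('k) ^ l)"
    using E.card_indep_mod_lists[of UNIV "{}" j] coords.card_indep_mod_lists[of "UNIV :: ('k ^ 'n) set" "{}" j]
    by (simp add: card_cartesian_product)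
  finally show ?thesis .
qed

end

section \<open>The success probability of one iteration\<close>

text \<open>Each of the \<open>k\<close> generators multiplies the size of the span by at most
  \<open>CARD('a)\<close>.\<close>

lemma card_Gab_le:
  fixes g :: "'a::{field,finite} ^ 'n"
  shows "card (Gab k g TYPE('k::{field,finite})) \<le> CARD('a) ^ k"
proof -
  let ?xs = "map (\<lambda>i. \<chi> j. (g $ j) ^ (CARD('k) ^ i)) [0..<k] :: ('a ^ 'n) list"
  have "Gab k g TYPE('k) = vec.span ({} \<union> set ?xs)"
    by (simp add: Gab_def lessThan_atLeast0)
  then show ?thesis
    using coords.card_span_Un_set_le[of "{}" ?xs] by simp
qed

lemma row_space_basis_matrix:
  fixes U :: "('k::{field,finite} ^ 'n) set"
  assumes "vec.subspace U" "vec.dim U = \<delta>"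
  shows "row_space \<delta> (basis_matrix \<delta> U) = U"
proof -
  obtain xs where xs: "length xs = \<delta>" "vec.span (set xs) = U"
    using coords.subspace_basis_list[OF assms(1)] assms(2) by auto
  have "(\<lambda>i. xs ! i) ` {..<\<delta>} = set xs"
    using xs(1) by (auto simp: set_conv_nth)
  then have "row_space \<delta> (\<lambda>i. xs ! i) = U"
    by (simp add: row_space_def xs(2))
  then have "\<exists>B. full_rank \<delta> B \<and> row_space \<delta> B = U"
    using assms(2) by (auto simp: full_rank_def intro!: exI[of _ "\<lambda>i. xs ! i"])
  then show ?thesis
    unfolding basis_matrix_def by (rule someI2_ex) simp
qed

context field_extension
begin

text \<open>The decoding condition in terms of the error \<open>e\<close> and \<epsilon>, with
  \<epsilon> moved to the right to avoid a truncated \<open>rk emb e - \<epsilon>\<close>.\<close>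

definition correctable :: "nat \<Rightarrow> nat \<Rightarrow> 'a ^ 'n \<Rightarrow> ('k ^ 'n) set \<Rightarrow> bool" where
  "correctable k \<delta> e U \<longleftrightarrow>
     2 * rk emb e + \<delta> \<le> CARD('n) - k + 2 * vec.dim (U \<inter> expanded_row_space e)"

text \<open>Only one direction of the equivalence of the two decoding conditions is used: the
  returned codeword has a small residual rank, and the rank of \<open>r - c\<close> exceeds it by at
  most \<epsilon>.\<close>

lemma rd_iteration_success:
  fixes U :: "('k ^ 'n) set"
  assumes U: "vec.subspace U" "vec.dim U = \<delta>" and "rd_iteration emb k g w \<delta> r U \<noteq> None"
  shows "\<exists>c\<in>Gab k g TYPE('k). rk emb (r - c) \<le> w \<and> correctable k \<delta> (r - c) U"
proof -
  let ?B = "basis_matrix \<delta> U"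
  let ?c = "SOME c. decodable emb k g \<delta> ?B r c"
  have "\<exists>c. decodable emb k g \<delta> ?B r c" and rk: "rk emb (r - ?c) \<le> w"
    using assms(3) unfolding rd_iteration_def error_erasure_decoder_def
    by (auto split: if_splits)
  then obtain c where c: "decodable emb k g \<delta> ?B r c" "rk emb (r - c) \<le> w"
    using someI_ex by metis
  then obtain a where a: "2 * rk emb (r - c - vec_mat_mult emb \<delta> a ?B) + \<delta> \<le> CARD('n) - k"
    by (auto simp: decodable_def)
  have "rk emb (r - c) \<le> rk emb (r - c - vec_mat_mult emb \<delta> a ?B) +
      vec.dim (U \<inter> expanded_row_space (r - c))"
    using rk_le_rk_diff_plus_dim_Int[of "r - c" \<delta> a ?B] by (simp add: row_space_basis_matrix[OF U])
  then show ?thesis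
    using a c by (auto simp: correctable_def decodable_def intro!: bexI[of _ c])
qed

text \<open>Sort the guesses by \<epsilon>. Correctability bounds \<epsilon> from below and the two
  dimensions bound it from above, which gives the summation range of \<open>P_succ\<close>. For
  small rank, all guesses are counted.\<close>

lemma card_correctable_le:
  fixes e :: "'a ^ 'n"
  assumes "\<delta> \<le> CARD('n)" "k \<le> CARD('n)"
  shows "real (card {U. vec.subspace U \<and> vec.dim U = \<delta> \<and> correctable k \<delta> e U}) \<le>
           real (gauss_binomial TYPE('k) CARD('n) \<delta>) * P_succ TYPE('k) CARD('n) k \<delta> (rk emb e)"
proof -
  let ?n = "CARD('n)" and ?j = "rk emb e" and ?R = "expanded_row_space e"
  let ?\<U> = "{U :: ('k ^ 'n) set. vec.subspace U \<and> vec.dim U = \<delta>}"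
  let ?C = "{U. vec.subspace U \<and> vec.dim U = \<delta> \<and> correctable k \<delta> e U}"
  have \<U>: "card ?\<U> = gauss_binomial TYPE('k) ?n \<delta>"
    using coords.card_subspaces[of "UNIV :: ('k ^ 'n) set" ?n \<delta>] by simp
  show ?thesis
  proof (cases "2 * ?j + \<delta> > ?n - k")
    case False
    have "card ?C \<le> card ?\<U>"
      by (intro card_mono) auto
    then show ?thesis
      using False \<U> by (simp add: P_succ_def)
  next
    case True
    let ?lo = "nat \<lceil>real ?j - (real ?n - real k) / 2 + real \<delta> / 2\<rceil>"
    let ?I = "\<lambda>i. {U. vec.subspace U \<and> U \<subseteq> UNIV \<and> vec.dim U = \<delta> \<and> vec.dim (U \<inter> ?R) = i}"
    let ?t = "\<lambda>i. gauss_binomial TYPE('k) (?n - ?j) (\<delta> - i) * gauss_binomial TYPE('k) ?j i *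
        CARD('k) ^ ((?j - i) * (\<delta> - i))"
    have "?C \<subseteq> (\<Union>i\<in>{?lo..min \<delta> ?j}. ?I i)"
    proof
      fix U assume U: "U \<in> ?C"
      let ?i = "vec.dim (U \<inter> ?R)"
      have "?i \<le> \<delta>"
        using U vec.dim_subset[of "U \<inter> ?R" U] by simp
      moreover have "?i \<le> ?j"
        using vec.dim_subset[of "U \<inter> ?R" ?R] by (simp add: dim_expanded_row_space)
      moreover have "?lo \<le> ?i"
      proof -
        have "2 * ?j + \<delta> \<le> ?n - k + 2 * ?i"
          using U by (simp only: mem_Collect_eq correctable_def)
        then have "2 * ?j + \<delta> + k \<le> ?n + 2 * ?i"
          using assms(2) by linarith
        then have "2 * real ?j + real \<delta> + real k \<le> real ?n + 2 * real ?i"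
          by linarith
        then show ?thesis
          by (simp add: nat_le_iff ceiling_le_iff field_simps)
      qed
      ultimately show "U \<in> (\<Union>i\<in>{?lo..min \<delta> ?j}. ?I i)"
        using U by auto
    qed
    then have "card ?C \<le> card (\<Union>i\<in>{?lo..min \<delta> ?j}. ?I i)"
      by (intro card_mono) auto
    also have "\<dots> \<le> (\<Sum>i\<in>{?lo..min \<delta> ?j}. card (?I i))"
      by (rule card_UN_le) simp
    also have "\<dots> \<le> (\<Sum>i\<in>{?lo..min \<delta> ?j}. ?t i)"
    proof (rule sum_mono)
      fix i assume "i \<in> {?lo..min \<delta> ?j}"
      then show "card (?I i) \<le> ?t i"
        using coords.card_subspaces_dim_Int_le[OF vec.subspace_UNIV _ _ subspace_expanded_row_space
            subset_UNIV dim_expanded_row_space[of e], of ?n i \<delta>] by simp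
    qed
    finally have "real (card ?C) \<le> (\<Sum>i\<in>{?lo..min \<delta> ?j}. real (?t i))"
      by (subst of_nat_sum[symmetric]) (rule of_nat_mono)
    moreover have "0 < gauss_binomial TYPE('k) ?n \<delta>"
      using assms(1) by (rule E.gauss_binomial_pos)
    ultimately show ?thesis
      using True by (simp add: P_succ_def mult.assoc[symmetric])
  qed
qed

text \<open>The product in \<open>A_bar\<close> is the bound on the number of words of rank
  \<open>j\<close> after division by the number of ordered bases. The power of q in front turns
  \<open>CARD('a) ^ n\<close> into \<open>CARD('a) ^ k\<close>.\<close>

lemma card_rk_eq_le_A_bar:
  assumes m: "CARD('a) = CARD('k) ^ m" and "k \<le> CARD('n)" "CARD('n) \<le> m"
  shows "real (card {e :: 'a ^ 'n. rk emb e = j}) * real CARD('a) ^ k \<le>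
           real CARD('a) ^ CARD('n) * A_bar CARD('k) m CARD('n) k j"
proof (cases "j \<le> CARD('n)")
  case True
  let ?q = "real CARD('k)" and ?n = "CARD('n)"
  let ?X = "\<Prod>l<j. ?q ^ m - ?q ^ l" and ?Y = "\<Prod>l<j. ?q ^ ?n - ?q ^ l" and ?N = "\<Prod>l<j. ?q ^ j - ?q ^ l"
  have q: "1 < ?q"
    using E.card_scalars_gt_1 by simp
  have real_prod: "real (\<Prod>l<j. CARD('k) ^ a - CARD('k) ^ l) = (\<Prod>l<j. ?q ^ a - ?q ^ l)" if "j \<le> a" for a
  proof -
    have "real (CARD('k) ^ a - CARD('k) ^ l) = ?q ^ a - ?q ^ l" if "l < j" for l
      using that \<open>j \<le> a\<close> by (subst of_nat_diff) (auto intro: power_increasing)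
    then show ?thesis
      by simp
  qed
  have N: "0 < ?N"
    using q by (intro prod_pos) auto
  have "real (card {e :: 'a ^ 'n. rk emb e = j}) * ?N \<le> ?X * ?Y"
    using card_rk_eq_mult_le[where ?'n = 'n, of j, THEN of_nat_mono[where ?'a = real]] True assms(3)
    by (simp only: of_nat_mult m real_prod order_refl order_trans[OF True])
  then have le: "real (card {e :: 'a ^ 'n. rk emb e = j}) \<le> ?X * ?Y / ?N"
    using N by (simp add: pos_le_divide_eq)
  have "A_bar CARD('k) m ?n k j = ?q powi (int m * (int k - int ?n)) * (?X * ?Y / ?N)"
    by (simp add: A_bar_def prod.distrib prod_dividef)
  moreover have "real CARD('a) ^ ?n * ?q powi (int m * (int k - int ?n)) = real CARD('a) ^ k"
  proof -
    have "?q powi int (m * ?n) * ?q powi (int m * (int k - int ?n)) = ?q powi int (m * k)"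
      using q by (subst power_int_add[symmetric]) (auto simp: algebra_simps)
    then show ?thesis
      by (simp only: m of_nat_power power_mult[symmetric] power_int_of_nat)
  qed
  ultimately have eq: "real CARD('a) ^ ?n * A_bar CARD('k) m ?n k j = (?X * ?Y / ?N) * real CARD('a) ^ k"
    by (simp only: mult.assoc[symmetric] mult.commute[of _ "real CARD('a) ^ k"])
  show ?thesis
    unfolding eq using le by (rule mult_right_mono) simp
next
  case False
  \<comment> \<open>Both sides vanish: no word has rank above \<open>CARD('n)\<close>, and the
    product has a zero factor at \<open>l = CARD('n)\<close>.\<close>
  have "rk emb e \<le> CARD('n)" for e :: "'a ^ 'n"
    using vec.dim_subset[OF subset_UNIV, of "expanded_row_space e"]
    by (simp add: dim_expanded_row_space vec_dim_card card_cart_basis)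
  then have "{e :: 'a ^ 'n. rk emb e = j} = {}"
    using False by auto
  moreover have "A_bar CARD('k) m CARD('n) k j = 0"
    using False by (auto simp: A_bar_def intro!: bexI[of _ "CARD('n)"])
  ultimately show ?thesis
    by simp
qed

section \<open>Averaging over the received words\<close>

lemma P_succ_nonneg: "0 \<le> P_succ T n k \<delta> j"
  by (simp add: P_succ_def sum_nonneg)

lemma sum_card_success_le:
  fixes g :: "'a ^ 'n"
  assumes m: "CARD('a) = CARD('k) ^ m" and k: "k \<le> CARD('n)" and n: "CARD('n) \<le> m" and \<delta>: "\<delta> \<le> CARD('n)"
  shows "(\<Sum>r\<in>UNIV. real (card {U. vec.subspace U \<and> vec.dim U = \<delta> \<and> rd_iteration emb k g w \<delta> r U \<noteq> None})) \<le>
    real CARD('a) ^ CARD('n) * real (gauss_binomial TYPE('k) CARD('n) \<delta>) *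
      (\<Sum>j = 0..w. A_bar CARD('k) m CARD('n) k j * P_succ TYPE('k) CARD('n) k \<delta> j)" (is "?lhs \<le> ?rhs")
proof -
  let ?n = "CARD('n)" and ?C = "Gab k g TYPE('k)" and ?G = "real (gauss_binomial TYPE('k) CARD('n) \<delta>)"
  let ?P = "\<lambda>j. P_succ TYPE('k) CARD('n) k \<delta> j" and ?A = "\<lambda>j. A_bar CARD('k) m CARD('n) k j"
  let ?K = "\<lambda>e. {U. vec.subspace U \<and> vec.dim U = \<delta> \<and> correctable k \<delta> e U}"
  \<comment> \<open>An upper bound for the number of guesses that can succeed with error
    \<open>e\<close>; words of rank above \<open>w\<close> are rejected and contribute 0.\<close>
  define f where "f e = (if rk emb e \<le> w then ?G * ?P (rk emb e) else 0)" for e :: "'a ^ 'n"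
  have "real (card {U. vec.subspace U \<and> vec.dim U = \<delta> \<and> rd_iteration emb k g w \<delta> r U \<noteq> None}) \<le>
      (\<Sum>c\<in>?C. f (r - c))" for r
  proof -
    let ?C' = "{c\<in>?C. rk emb (r - c) \<le> w}"
    have "{U. vec.subspace U \<and> vec.dim U = \<delta> \<and> rd_iteration emb k g w \<delta> r U \<noteq> None} \<subseteq>
        (\<Union>c\<in>?C'. ?K (r - c))"
    proof
      fix U assume "U \<in> {U. vec.subspace U \<and> vec.dim U = \<delta> \<and> rd_iteration emb k g w \<delta> r U \<noteq> None}"
      then show "U \<in> (\<Union>c\<in>?C'. ?K (r - c))"
        using rd_iteration_success[of U \<delta> k g w r] by auto
    qed
    then have "card {U. vec.subspace U \<and> vec.dim U = \<delta> \<and> rd_iteration emb k g w \<delta> r U \<noteq> None} \<le>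
        card (\<Union>c\<in>?C'. ?K (r - c))"
      by (intro card_mono) auto
    also have "\<dots> \<le> (\<Sum>c\<in>?C'. card (?K (r - c)))"
      by (rule card_UN_le) simp
    finally have "real (card {U. vec.subspace U \<and> vec.dim U = \<delta> \<and> rd_iteration emb k g w \<delta> r U \<noteq> None}) \<le>
        (\<Sum>c\<in>?C'. real (card (?K (r - c))))"
      by (subst of_nat_sum[symmetric]) (rule of_nat_mono)
    also have "\<dots> \<le> (\<Sum>c\<in>?C'. f (r - c))"
      by (rule sum_mono) (use card_correctable_le[OF \<delta> k] in \<open>auto simp: f_def\<close>)
    also have "\<dots> \<le> (\<Sum>c\<in>?C. f (r - c))"
      by (rule sum_mono2) (auto simp: f_def P_succ_nonneg)
    finally show ?thesis .
  qed
  then have "?lhs \<le> (\<Sum>r\<in>UNIV. \<Sum>c\<in>?C. f (r - c))"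
    by (rule sum_mono)
  also have "\<dots> = (\<Sum>c\<in>?C. \<Sum>r\<in>UNIV. f (r - c))"
    by (rule sum.swap)
  also have "\<dots> = (\<Sum>c\<in>?C. \<Sum>e\<in>UNIV. f e)"
  proof (rule sum.cong[OF refl])
    fix c
    show "(\<Sum>r\<in>UNIV. f (r - c)) = (\<Sum>e\<in>UNIV. f e)"
      \<comment> \<open>Translation by a codeword permutes all words, so every codeword contributes
        the same sum over errors.\<close>
      by (rule sum.reindex_bij_witness[of _ "\<lambda>e. e + c" "\<lambda>r. r - c"]) auto
  qed
  also have "\<dots> = real (card ?C) * (\<Sum>e\<in>UNIV. f e)"
    by simp
  also have "\<dots> \<le> real CARD('a) ^ k * (\<Sum>e\<in>UNIV. f e)"
  proof (rule mult_right_mono)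
    show "real (card ?C) \<le> real CARD('a) ^ k"
      using card_Gab_le[of k g, where ?'k = 'k] by (subst of_nat_power[symmetric]) (rule of_nat_mono)
    show "0 \<le> (\<Sum>e\<in>UNIV. f e)"
      by (intro sum_nonneg) (auto simp: f_def P_succ_nonneg)
  qed
  also have "(\<Sum>e\<in>UNIV. f e) = (\<Sum>e\<in>{e :: 'a ^ 'n. rk emb e \<in> {0..w}}. ?G * ?P (rk emb e))"
    by (rule sum.mono_neutral_cong_right) (auto simp: f_def)
  also have "\<dots> = (\<Sum>j = 0..w. \<Sum>e\<in>{e \<in> {e :: 'a ^ 'n. rk emb e \<in> {0..w}}. rk emb e = j}. ?G * ?P (rk emb e))"
    by (rule sum.group[symmetric]) auto
  also have "\<dots> = (\<Sum>j = 0..w. real (card {e :: 'a ^ 'n. rk emb e = j}) * (?G * ?P j))"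
  proof (rule sum.cong[OF refl])
    fix j assume "j \<in> {0..w}"
    then have "{e \<in> {e :: 'a ^ 'n. rk emb e \<in> {0..w}}. rk emb e = j} = {e. rk emb e = j}"
      by auto
    then show "(\<Sum>e\<in>{e \<in> {e :: 'a ^ 'n. rk emb e \<in> {0..w}}. rk emb e = j}. ?G * ?P (rk emb e)) =
        real (card {e :: 'a ^ 'n. rk emb e = j}) * (?G * ?P j)"
      by simp
  qed
  also have "real CARD('a) ^ k * \<dots> = (\<Sum>j = 0..w. (real (card {e :: 'a ^ 'n. rk emb e = j}) * real CARD('a) ^ k) * (?G * ?P j))"
    by (simp add: sum_distrib_left mult_ac)
  also have "\<dots> \<le> (\<Sum>j = 0..w. (real CARD('a) ^ CARD('n) * ?A j) * (?G * ?P j))"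
    by (intro sum_mono mult_right_mono card_rk_eq_le_A_bar[OF m k n] mult_nonneg_nonneg P_succ_nonneg) simp
  also have "\<dots> = ?rhs"
    by (simp add: sum_distrib_left mult_ac)
  finally show ?thesis .
qed

end

section \<open>The expected number of iterations\<close>

text \<open>The number of iterations for a fixed received word, with success abstracted to a
  predicate on guesses.\<close>

definition waiting_time :: "('b \<Rightarrow> bool) \<Rightarrow> (nat \<Rightarrow> 'b) \<Rightarrow> ennreal" where
  "waiting_time Q \<omega> = (if \<exists>i. Q (\<omega> i) then of_nat (Suc (LEAST i. Q (\<omega> i))) else \<infinity>)"


text \<open>Tail sum: the waiting time counts the \<open>t\<close> for which the first
  \<open>t\<close> trials all fail, including \<open>t = 0\<close>. This also covers the infinite
  case.\<close>

lemma waiting_time_eq_suminf: "waiting_time Q \<omega> = (\<Sum>t. indicator {\<omega>. \<forall>i<t. \<not> Q (\<omega> i)} \<omega>)"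
proof (cases "\<exists>i. Q (\<omega> i)")
  case True
  define L where "L = (LEAST i. Q (\<omega> i))"
  have Q: "Q (\<omega> L)"
    unfolding L_def using True by (rule LeastI_ex)
  have not_Q: "\<not> Q (\<omega> i)" if "i < L" for i
    using that unfolding L_def by (rule not_less_Least)
  have "(\<forall>i<t. \<not> Q (\<omega> i)) \<longleftrightarrow> t < Suc L" for t
  proof
    assume "\<forall>i<t. \<not> Q (\<omega> i)"
    then have "\<not> L < t"
      using Q by blast
    then show "t < Suc L"
      by simp
  next
    assume "t < Suc L"
    then show "\<forall>i<t. \<not> Q (\<omega> i)"
      using not_Q by auto
  qed
  then have "(\<Sum>t. indicator {\<omega>. \<forall>i<t. \<not> Q (\<omega> i)} \<omega>) = (\<Sum>t. indicator {..<Suc L} t :: ennreal)"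
    by (simp add: indicator_def)
  also have "\<dots> = (\<Sum>t<Suc L. indicator {..<Suc L} t)"
    by (rule suminf_finite) auto
  also have "\<dots> = of_nat (Suc L)"
    by simp
  finally show ?thesis
    using True by (simp add: waiting_time_def L_def)
next
  case False
  have le: "of_nat n \<le> (\<Sum>t. 1 :: ennreal)" for n
    using sum_le_suminf[OF summableI, of "{..<n}" "\<lambda>_. 1 :: ennreal"] by simp
  have "\<not> (\<Sum>t. 1 :: ennreal) < top"
  proof
    assume "(\<Sum>t. 1 :: ennreal) < top"
    then obtain n where "(\<Sum>t. 1 :: ennreal) < of_nat n"
      using ennreal_Ex_less_of_nat by blast
    then show False
      using le[of n] by (simp add: not_less[symmetric])
  qed
  then have "(\<Sum>t. 1 :: ennreal) = \<infinity>"
    by (simp add: not_less top_unique)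
  then show ?thesis
    using False by (simp add: waiting_time_def)
qed

lemma measurable_waiting_time [measurable]:
  "waiting_time Q \<in> borel_measurable (\<Pi>\<^sub>M i\<in>(UNIV :: nat set). measure_pmf D)"
proof -
  have [measurable]: "Measurable.pred (measure_pmf D) Q"
    by simp
  have "(\<lambda>\<omega>. \<Sum>t. indicator {\<omega>. \<forall>i<t. \<not> Q (\<omega> i)} \<omega> :: ennreal) \<in>
      borel_measurable (\<Pi>\<^sub>M i\<in>(UNIV :: nat set). measure_pmf D)"
    unfolding indicator_def by measurable
  then show ?thesis
    by (simp add: waiting_time_eq_suminf[abs_def])
qed

text \<open>By independence the first \<open>t\<close> trials all fail with probability
  \<open>(1 - p) ^ t\<close>. The value is left as a series, which is infinite for
  \<open>p = 0\<close>.\<close>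

lemma nn_integral_waiting_time:
  "(\<integral>\<^sup>+ \<omega>. waiting_time Q \<omega> \<partial>(\<Pi>\<^sub>M i\<in>(UNIV :: nat set). measure_pmf D)) =
     (\<Sum>t. ennreal ((1 - measure_pmf.prob D {u. Q u}) ^ t))"
proof -
  let ?M = "\<Pi>\<^sub>M i\<in>(UNIV :: nat set). measure_pmf D"
  have [measurable]: "Measurable.pred (measure_pmf D) Q"
    by simp
  interpret product_prob_space "\<lambda>_. measure_pmf D" "UNIV :: nat set"
    by unfold_locales
  have eq: "{\<omega>. \<forall>i<t. \<not> Q (\<omega> i)} = {\<omega>\<in>space ?M. \<forall>i\<in>{..<t}. \<omega> i \<in> {u. \<not> Q u}}" for t :: nat
    by (auto simp: space_PiM)
  have em: "emeasure ?M {\<omega>. \<forall>i<t. \<not> Q (\<omega> i)} = ennreal ((1 - measure_pmf.prob D {u. Q u}) ^ t)" for t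
  proof -
    have "emeasure ?M {\<omega>. \<forall>i<t. \<not> Q (\<omega> i)} = (\<Prod>i<t. emeasure (measure_pmf D) {u. \<not> Q u})"
      unfolding eq by (rule emeasure_PiM_Collect) auto
    also have "emeasure (measure_pmf D) {u. \<not> Q u} = ennreal (1 - measure_pmf.prob D {u. Q u})"
      using measure_pmf.prob_neg[of D Q] by (simp add: measure_pmf.emeasure_eq_measure)
    finally show ?thesis
      by (simp add: ennreal_power)
  qed
  have sets: "{\<omega>. \<forall>i<t. \<not> Q (\<omega> i)} \<in> sets ?M" for t
    unfolding eq by measurable
  have "(\<integral>\<^sup>+ \<omega>. waiting_time Q \<omega> \<partial>?M) = (\<Sum>t. \<integral>\<^sup>+ \<omega>. indicator {\<omega>. \<forall>i<t. \<not> Q (\<omega> i)} \<omega> \<partial>?M)"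
    unfolding waiting_time_eq_suminf using sets by (intro nn_integral_suminf) auto
  also have "\<dots> = (\<Sum>t. ennreal ((1 - measure_pmf.prob D {u. Q u}) ^ t))"
    using sets by (simp add: em)
  finally show ?thesis .
qed

text \<open>
  The tangent of the convex function \<open>p \<mapsto> 1 / p\<close> at \<open>s\<close>: it turns Jensen's inequality into an
  average of linear bounds and also covers \<open>p = 0\<close>.
\<close>

lemma tangent_le_suminf_geometric:
  assumes s: "0 < s" and p: "0 \<le> p" "p \<le> (1 :: real)"
  shows "ennreal (2 / s - p / s\<^sup>2) \<le> (\<Sum>t. ennreal ((1 - p) ^ t))"
proof (cases "p = 0")
  case True
  \<comment> \<open>All terms are 1, as for trials that never succeed.\<close>
  then have "(\<Sum>t. ennreal ((1 - p) ^ t)) = waiting_time (\<lambda>_. False) (\<lambda>_. ())"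
    by (simp add: waiting_time_eq_suminf)
  then show ?thesis
    by (simp add: waiting_time_def)
next
  case False
  then have "(\<lambda>t. (1 - p) ^ t) sums (1 / p)"
    using p geometric_sums[of "1 - p"] by simp
  then have "(\<Sum>t. ennreal ((1 - p) ^ t)) = ennreal (1 / p)"
    using p by (subst suminf_ennreal2) (auto simp: sums_iff)
  moreover have "2 / s - p / s\<^sup>2 \<le> 1 / p"
  proof -
    \<comment> \<open>The gap between \<open>1 / p\<close> and its tangent at
      \<open>s\<close>.\<close>
    have "0 \<le> (s - p)\<^sup>2 / (s\<^sup>2 * p)"
      using p by simp
    also have "\<dots> = 1 / p - (2 / s - p / s\<^sup>2)"
      using s False by (simp add: field_simps power2_eq_square)
    finally show ?thesis
      by simp
  qed
  ultimately show ?thesis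
    by (simp add: ennreal_leI)
qed

lemma rd_average_cost_eq:
  fixes g :: "'a::{field,finite} ^ 'n" and emb :: "'k::{field,finite} \<Rightarrow> 'a"
  shows "rd_average_cost emb k g w \<delta> = of_nat (CARD('n) ^ 2) *
    ((\<Sum>r\<in>UNIV. \<Sum>t. ennreal ((1 - measure_pmf.prob (guess_pmf \<delta>)
        {U. rd_iteration emb k g w \<delta> r U \<noteq> None}) ^ t)) / of_nat CARD('a ^ 'n))"
proof -
  let ?M = "\<Pi>\<^sub>M i\<in>(UNIV :: nat set). measure_pmf (guess_pmf \<delta> :: ('k ^ 'n) set pmf)"
  let ?R = "measure_pmf (pmf_of_set (UNIV :: ('a ^ 'n) set))"
  let ?Q = "\<lambda>r U. rd_iteration emb k g w \<delta> r U \<noteq> None"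
  interpret prob_space ?M
    by (intro prob_space_PiM measure_pmf.prob_space_axioms)
  \<comment> \<open>The first component ranges over a countable set, so measurability for each fixed
    \<open>r\<close> suffices.\<close>
  have "(\<lambda>(r, \<omega>). waiting_time (?Q r) \<omega>) \<in> borel_measurable (count_space UNIV \<Otimes>\<^sub>M ?M)"
    by (rule measurable_pair_measure_countable1) auto
  then have meas: "(\<lambda>(r, \<omega>). waiting_time (?Q r) \<omega>) \<in> borel_measurable (?R \<Otimes>\<^sub>M ?M)"
    by (simp cong: measurable_cong_sets sets_pair_measure_cong)
  have "(\<integral>\<^sup>+ (r, \<omega>). rd_num_iterations emb k g w \<delta> r \<omega> \<partial>rd_space \<delta>) =
      (\<integral>\<^sup>+ (r, \<omega>). waiting_time (?Q r) \<omega> \<partial>(?R \<Otimes>\<^sub>M ?M))"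
    unfolding rd_num_iterations_def waiting_time_def rd_space_def ..
  also have "\<dots> = (\<integral>\<^sup>+ r. \<integral>\<^sup>+ \<omega>. waiting_time (?Q r) \<omega> \<partial>?M \<partial>?R)"
    using nn_integral_fst[OF meas] by simp
  also have "\<dots> = (\<Sum>r\<in>UNIV. \<integral>\<^sup>+ \<omega>. waiting_time (?Q r) \<omega> \<partial>?M) / of_nat CARD('a ^ 'n)"
    by (subst nn_integral_pmf_of_set) auto
  finally show ?thesis
    by (simp only: rd_average_cost_def nn_integral_waiting_time)
qed

text \<open>Negative summands become 0 under \<open>ennreal\<close>, which can only raise the sum.
  The tangent values may be negative.\<close>

lemma ennreal_sum_le: "ennreal (\<Sum>i\<in>A. x i) \<le> (\<Sum>i\<in>A. ennreal (x i))"
proof -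
  have "ennreal (\<Sum>i\<in>A. x i) \<le> ennreal (\<Sum>i\<in>A. max 0 (x i))"
    by (intro ennreal_leI sum_mono) simp
  also have "\<dots> = (\<Sum>i\<in>A. ennreal (max 0 (x i)))"
    by (rule sum_ennreal[symmetric]) simp
  also have "(\<lambda>i. ennreal (max 0 (x i))) = (\<lambda>i. ennreal (x i))"
    by (simp add: fun_eq_iff max_def ennreal_neg)
  finally show ?thesis .
qed

lemma rd_average_cost_ge:
  fixes g :: "'a::{field,finite} ^ 'n" and emb :: "'k::{field,finite} \<Rightarrow> 'a"
  assumes s: "0 < s"
    and le: "(\<Sum>r\<in>UNIV. measure_pmf.prob (guess_pmf \<delta>) {U. rd_iteration emb k g w \<delta> r U \<noteq> None}) \<le>
      real CARD('a) ^ CARD('n) * s"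
  shows "ennreal (real CARD('n) ^ 2 / s) \<le> rd_average_cost emb k g w \<delta>"
proof -
  let ?p = "\<lambda>r. measure_pmf.prob (guess_pmf \<delta>) {U. rd_iteration emb k g w \<delta> r U \<noteq> None}"
  let ?c = "real CARD('a ^ 'n)"
  have c: "?c = real CARD('a) ^ CARD('n)" "0 < ?c"
    by simp_all
  \<comment> \<open>At \<open>p = s\<close> the tangent takes the value \<open>1 / s\<close>; it
    decreases in \<open>p\<close>, so a mean of at most \<open>s\<close> keeps the averaged tangent
    above \<open>1 / s\<close>.\<close>
  have "?c / s = 2 * (?c / s) - ?c * s / s\<^sup>2"
    using s by (simp add: power2_eq_square)
  also have "\<dots> \<le> 2 * (?c / s) - (\<Sum>r\<in>UNIV. ?p r) / s\<^sup>2"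
    using le unfolding c(1) by (intro diff_left_mono divide_right_mono) simp_all
  also have "\<dots> = (\<Sum>r\<in>UNIV. 2 / s - ?p r / s\<^sup>2)"
    by (simp add: sum_subtractf sum_divide_distrib)
  finally have "ennreal (?c / s) \<le> ennreal (\<Sum>r\<in>UNIV. 2 / s - ?p r / s\<^sup>2)"
    by (rule ennreal_leI)
  then have "ennreal (?c / s) / of_nat CARD('a ^ 'n) \<le>
      ennreal (\<Sum>r\<in>UNIV. 2 / s - ?p r / s\<^sup>2) / of_nat CARD('a ^ 'n)"
    by (rule divide_right_mono_ennreal)
  moreover have "ennreal (?c / s) / of_nat CARD('a ^ 'n) = ennreal (1 / s)"
  proof -
    have "ennreal (?c / s) / ennreal ?c = ennreal (?c / s / ?c)"
      using s c(2) by (intro divide_ennreal) auto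
    also have "?c / s / ?c = 1 / s"
      using c(2) by (metis divide_divide_eq_left' divide_self_if less_irrefl nonzero_divide_mult_cancel_left)
    finally show ?thesis
      by (simp only: ennreal_of_nat_eq_real_of_nat)
  qed
  ultimately have "ennreal (1 / s) \<le> ennreal (\<Sum>r\<in>UNIV. 2 / s - ?p r / s\<^sup>2) / of_nat CARD('a ^ 'n)"
    by (simp only:)
  also have "\<dots> \<le> (\<Sum>r\<in>UNIV. ennreal (2 / s - ?p r / s\<^sup>2)) / of_nat CARD('a ^ 'n)"
    by (intro divide_right_mono_ennreal ennreal_sum_le)
  also have "\<dots> \<le> (\<Sum>r\<in>UNIV. \<Sum>t. ennreal ((1 - ?p r) ^ t)) / of_nat CARD('a ^ 'n)"
    by (intro divide_right_mono_ennreal sum_mono tangent_le_suminf_geometric[OF s]) auto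
  finally have "of_nat (CARD('n) ^ 2) * ennreal (1 / s) \<le> rd_average_cost emb k g w \<delta>"
    unfolding rd_average_cost_eq by (rule mult_left_mono) simp
  moreover have "of_nat (CARD('n) ^ 2) * ennreal (1 / s) = ennreal (real CARD('n) ^ 2 / s)"
    using s by (simp add: ennreal_of_nat_eq_real_of_nat ennreal_mult'[symmetric])
  ultimately show ?thesis
    by simp
qed

section \<open>The bound\<close>

context field_extension
begin

lemma sum_prob_success_le:
  fixes g :: "'a ^ 'n"
  assumes "CARD('a) = CARD('k) ^ m" "k \<le> CARD('n)" "CARD('n) \<le> m" "\<delta> \<le> CARD('n)"
  shows "(\<Sum>r\<in>UNIV. measure_pmf.prob (guess_pmf \<delta>) {U. rd_iteration emb k g w \<delta> r U \<noteq> None}) \<le>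
    real CARD('a) ^ CARD('n) *
      (\<Sum>j = 0..w. A_bar CARD('k) m CARD('n) k j * P_succ TYPE('k) CARD('n) k \<delta> j)"
proof -
  let ?\<U> = "{U :: ('k ^ 'n) set. vec.subspace U \<and> vec.dim U = \<delta>}"
  let ?G = "gauss_binomial TYPE('k) CARD('n) \<delta>"
  have G: "card ?\<U> = ?G" "0 < ?G"
    using coords.card_subspaces[of "UNIV :: ('k ^ 'n) set" "CARD('n)" \<delta>] E.gauss_binomial_pos[OF assms(4)]
    by simp_all
  \<comment> \<open>\<open>pmf_of_set\<close> is the uniform distribution only for a nonempty
    set.\<close>
  then have "?\<U> \<noteq> {}"
    by (metis card.empty less_irrefl)
  have prob: "measure_pmf.prob (guess_pmf \<delta>) {U. rd_iteration emb k g w \<delta> r U \<noteq> None} =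
      real (card {U. vec.subspace U \<and> vec.dim U = \<delta> \<and> rd_iteration emb k g w \<delta> r U \<noteq> None}) / real ?G" for r
  proof -
    have "?\<U> \<inter> {U. rd_iteration emb k g w \<delta> r U \<noteq> None} =
        {U. vec.subspace U \<and> vec.dim U = \<delta> \<and> rd_iteration emb k g w \<delta> r U \<noteq> None}"
      by blast
    then show ?thesis
      unfolding guess_pmf_def by (subst measure_pmf_of_set[OF \<open>?\<U> \<noteq> {}\<close>]) (simp_all only: G(1) finite)
  qed
  show ?thesis
    unfolding prob sum_divide_distrib[symmetric]
    using sum_card_success_le[OF assms, of g w] G(2) by (subst pos_divide_le_eq) (simp_all only: of_nat_0_less_iff mult_ac)
qed

end

text \<open>The sum is split where \<open>P_succ\<close> changes its form. Below the split it is 1;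
  above it the Gaussian binomial cancels its inverse.\<close>

lemma P_succ_sum_expand:
  assumes k: "k \<le> n" and \<delta>: "\<delta> \<le> n" "\<delta> + k \<le> n" and w: "n \<le> k + 2 * w + \<delta>"
  shows "real (gauss_binomial TYPE('k::{field,finite}) n \<delta>) * (\<Sum>j = 0..w. A j * P_succ TYPE('k) n k \<delta> j) =
     real (gauss_binomial TYPE('k) n \<delta>) * (\<Sum>j = 0..nat \<lfloor>(real n - real k - real \<delta>) / 2\<rfloor>. A j) +
     (\<Sum>j = nat \<lfloor>(real n - real k - real \<delta>) / 2\<rfloor> + 1..w.
        A j * (\<Sum>i = nat \<lceil>real j - (real n - real k) / 2 + real \<delta> / 2\<rceil>..min \<delta> j.
           real (gauss_binomial TYPE('k) (n - j) (\<delta> - i)) * real (gauss_binomial TYPE('k) j i) *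
           real CARD('k) ^ ((j - i) * (\<delta> - i))))"
proof -
  let ?F = "nat \<lfloor>(real n - real k - real \<delta>) / 2\<rfloor>" and ?G = "real (gauss_binomial TYPE('k) n \<delta>)"
  have F: "j \<le> ?F \<longleftrightarrow> 2 * j + \<delta> \<le> n - k" for j
  proof -
    have "0 \<le> (real n - real k - real \<delta>) / 2"
      using \<delta> by (simp add: field_simps flip: of_nat_add)
    then have "j \<le> ?F \<longleftrightarrow> real j \<le> (real n - real k - real \<delta>) / 2"
      by (simp add: le_nat_iff le_floor_iff)
    also have "\<dots> \<longleftrightarrow> 2 * real j + real \<delta> + real k \<le> real n"
      by (simp add: field_simps)
    also have "\<dots> \<longleftrightarrow> 2 * j + \<delta> \<le> n - k"
      using k by linarith
    finally show ?thesis .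
  qed
  interpret F: finite_field_space "fun_scale :: 'k \<Rightarrow> (nat \<Rightarrow> 'k) \<Rightarrow> _"
    by (simp add: finite_field_space_def vector_space_fun_scale)
  have G: "?G \<noteq> 0"
    using F.gauss_binomial_pos[OF \<delta>(1)] by simp
  \<comment> \<open>The assumption on \<open>w\<close> places the split inside the range of
    summation.\<close>
  have "?F \<le> w"
    using F[of ?F] w by simp
  then have split: "{0..w} = {0..?F} \<union> {?F + 1..w}"
    by auto
  have "(\<Sum>j = 0..w. A j * P_succ TYPE('k) n k \<delta> j) =
      (\<Sum>j = 0..?F. A j * P_succ TYPE('k) n k \<delta> j) + (\<Sum>j = ?F + 1..w. A j * P_succ TYPE('k) n k \<delta> j)"
    unfolding split by (rule sum.union_disjoint) auto
  also have "(\<Sum>j = 0..?F. A j * P_succ TYPE('k) n k \<delta> j) = (\<Sum>j = 0..?F. A j)"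
    by (rule sum.cong) (auto simp: P_succ_def F)
  finally have "?G * (\<Sum>j = 0..w. A j * P_succ TYPE('k) n k \<delta> j) =
      ?G * (\<Sum>j = 0..?F. A j) + (\<Sum>j = ?F + 1..w. A j * (?G * P_succ TYPE('k) n k \<delta> j))"
    by (simp add: distrib_left sum_distrib_left mult_ac)
  also have "(\<Sum>j = ?F + 1..w. A j * (?G * P_succ TYPE('k) n k \<delta> j)) =
     (\<Sum>j = ?F + 1..w.
        A j * (\<Sum>i = nat \<lceil>real j - (real n - real k) / 2 + real \<delta> / 2\<rceil>..min \<delta> j.
           real (gauss_binomial TYPE('k) (n - j) (\<delta> - i)) * real (gauss_binomial TYPE('k) j i) *
           real CARD('k) ^ ((j - i) * (\<delta> - i))))"
  proof (rule sum.cong[OF refl])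
    fix j assume "j \<in> {?F + 1..w}"
    then have "\<not> 2 * j + \<delta> \<le> n - k"
      using F[of j] by simp
    then show "A j * (?G * P_succ TYPE('k) n k \<delta> j) =
       A j * (\<Sum>i = nat \<lceil>real j - (real n - real k) / 2 + real \<delta> / 2\<rceil>..min \<delta> j.
           real (gauss_binomial TYPE('k) (n - j) (\<delta> - i)) * real (gauss_binomial TYPE('k) j i) *
           real CARD('k) ^ ((j - i) * (\<delta> - i)))"
      using G by (simp add: P_succ_def)
  qed
  finally show ?thesis .
qed

theorem theorem1:
  fixes emb :: "'k::{field,finite} \<Rightarrow> 'a::{field,finite}"
    and g :: "'a ^ 'n"
    and q m n k w :: nat
    and \<xi> :: real
  assumes "q = CARD('k)"
    and "field_embedding emb"
    and "ext_degree emb = m"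
    and "n = CARD('n)"
    and "1 \<le> k" and "k \<le> n" and "n \<le> m"
    and "real w > (real n - real k) / 2"
    and "\<xi> = real w - (real n - real k) / 2"
    and "lin_indep_entries emb g"
  shows "(\<forall>\<delta> \<in> erasure_range n k \<xi>.
            ennreal (W_RD TYPE('k) m n k w \<xi>) \<le> rd_average_cost emb k g w \<delta>) \<and>
         W_RD TYPE('k) m n k w \<xi> =
           Min ((\<lambda>\<delta>.
              real n ^ 2 * real (gauss_binomial TYPE('k) n \<delta>) /
              (real (gauss_binomial TYPE('k) n \<delta>) *
                 (\<Sum>j = 0..nat \<lfloor>(real n - real k - real \<delta>) / 2\<rfloor>. A_bar q m n k j) +
               (\<Sum>j = nat \<lfloor>(real n - real k - real \<delta>) / 2\<rfloor> + 1..w.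
                  A_bar q m n k j *
                  (\<Sum>i = nat \<lceil>real j - (real n - real k) / 2 + real \<delta> / 2\<rceil>..min \<delta> j.
                     real (gauss_binomial TYPE('k) (n - j) (\<delta> - i)) *
                     real (gauss_binomial TYPE('k) j i) *
                     real q ^ ((j - i) * (\<delta> - i))))))
             ` erasure_range n k \<xi>)"
proof -
  let ?P = "\<lambda>\<delta> j. P_succ TYPE('k) n k \<delta> j" and ?A = "A_bar q m n k"
  let ?W = "\<lambda>\<delta>. real n ^ 2 / (\<Sum>j = 0..w. ?A j * ?P \<delta> j)"
  interpret field_extension emb
    by unfold_locales (rule assms)
  have card_a: "CARD('a) = CARD('k) ^ m"
    using E.card_subspace[of UNIV] assms(3) by (simp add: ext_degree_def)
  \<comment> \<open>The last inequality comes from \<open>2 * w > n - k\<close>.\<close>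
  have range: "\<delta> \<le> n" "\<delta> + k \<le> n" "n \<le> k + 2 * w + \<delta>" if "\<delta> \<in> erasure_range n k \<xi>" for \<delta>
    using that assms(8,9) by (auto simp: erasure_range_def)
  have fin: "finite (erasure_range n k \<xi>)"
    by (rule finite_subset[of _ "{..n}"]) (use range in auto)
  have "ennreal (W_RD TYPE('k) m n k w \<xi>) \<le> rd_average_cost emb k g w \<delta>"
    if \<delta>: "\<delta> \<in> erasure_range n k \<xi>" for \<delta>
  proof -
    let ?s = "\<Sum>j = 0..w. ?A j * ?P \<delta> j"
    have "W_RD TYPE('k) m n k w \<xi> \<le> ?W \<delta>"
      unfolding W_RD_def using fin \<delta> assms(1) by (intro Min_le) auto
    then have "ennreal (W_RD TYPE('k) m n k w \<xi>) \<le> ennreal (real n ^ 2 / ?s)"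
      by (rule ennreal_leI)
    also have "\<dots> \<le> rd_average_cost emb k g w \<delta>"
    proof (cases "0 < ?s")
      case True
      then show ?thesis
        using rd_average_cost_ge[OF True] sum_prob_success_le[OF card_a, of k \<delta> g w] assms(1,4,6,7) range(1)[OF \<delta>]
        by simp
    next
      \<comment> \<open>The real quotient is then at most 0, with division by zero giving 0, and
        \<open>ennreal\<close> maps it to 0.\<close>
      case False
      then show ?thesis
        by (simp add: ennreal_neg divide_nonneg_nonpos)
    qed
    finally show ?thesis .
  qed
  moreover have "?W \<delta> =
      real n ^ 2 * real (gauss_binomial TYPE('k) n \<delta>) /
              (real (gauss_binomial TYPE('k) n \<delta>) *
                 (\<Sum>j = 0..nat \<lfloor>(real n - real k - real \<delta>) / 2\<rfloor>. A_bar q m n k j) +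
               (\<Sum>j = nat \<lfloor>(real n - real k - real \<delta>) / 2\<rfloor> + 1..w.
                  A_bar q m n k j *
                  (\<Sum>i = nat \<lceil>real j - (real n - real k) / 2 + real \<delta> / 2\<rceil>..min \<delta> j.
                     real (gauss_binomial TYPE('k) (n - j) (\<delta> - i)) *
                     real (gauss_binomial TYPE('k) j i) *
                     real q ^ ((j - i) * (\<delta> - i)))))"
    if \<delta>: "\<delta> \<in> erasure_range n k \<xi>" for \<delta>
  proof -
    have "real (gauss_binomial TYPE('k) n \<delta>) \<noteq> 0"
      using E.gauss_binomial_pos[OF range(1)[OF \<delta>]] by simp
    then show ?thesis
      unfolding assms(1) P_succ_sum_expand[OF assms(6) range[OF \<delta>], symmetric]
      by (simp add: mult.commute)
  qed
  ultimately show ?thesis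
    unfolding W_RD_def assms(1)[symmetric] by (intro conjI ballI arg_cong[where f = Min] image_cong) auto
qed

end
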